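(* Let $A$ be a noetherian commutative ring, $\mathfrak{a}$-adically complete with respect to an ideal $\mathfrak{a}$, and let $A_0 := A/\mathfrak{a}$. Let $M \in \mathsf{D}(\mathsf{Mod}\, A)^-_{\mathfrak{a}\text{-com}}$. If $A_0 \otimes^{\mathrm{L}}_A M = 0$ then $M = 0$ (in $\mathsf{D}(\mathsf{Mod}\, A)$).
   Context: For an $A$-module $M$, $\Lambda_{\mathfrak{a}}(M) := \varprojlim_i M/\mathfrak{a}^i M$, with canonical homomorphism $\tau_M : M \to \Lambda_{\mathfrak{a}}(M)$. The left derived functor $\mathrm{L}\Lambda_{\mathfrak{a}}$ on $\mathsf{D}(\mathsf{Mod}\, A)$ is computed by $\mathrm{L}\Lambda_{\mathfrak{a}}(M) = \Lambda_{\mathfrak{a}}(Q)$ for a K-projective resolution $Q \to M$, and the canonical morphism $\tau^{\mathrm{L}}_M : M \to \mathrm{L}\Lambda_{\mathfrak{a}}(M)$ is represented by $\tau_Q$. A complex $M$ is cohomologically $\mathfrak{a}$-adically complete if $\tau^{\mathrm{L}}_M$ is an isomorphism. $\mathsf{D}(\mathsf{Mod}\, A)^-_{\mathfrak{a}\text{-com}}$ is the full subcategory of $\mathsf{D}(\mathsf{Mod}\, A)$ of cohomologically $\mathfrak{a}$-adically complete complexes with bounded above cohomology. *)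

theory Defs
  imports "HOL-Algebra.Module" "HOL-Algebra.Ideal_Product" "HOL-Algebra.Ring_Divisibility"
begin

section \<open>Modules\<close>

text \<open>
  Modules are the records of HOL-Algebra, with the locale \<open>module\<close>. These records extend ring
  records; the ring multiplication and the ring unit of a module carry no meaning and are left
  undefined.
\<close>

definition mk_module ::
  "'m set \<Rightarrow> 'm \<Rightarrow> ('m \<Rightarrow> 'm \<Rightarrow> 'm) \<Rightarrow> ('a \<Rightarrow> 'm \<Rightarrow> 'm) \<Rightarrow> ('a, 'm) module" where
  "mk_module C z p s =
     \<lparr>carrier = C, monoid.mult = undefined, monoid.one = undefined, ring.zero = z, ring.add = p, smult = s\<rparr>"

definition regular_module :: "('a, 'r) ring_scheme \<Rightarrow> ('a, 'a) module" where
  "regular_module A = mk_module (carrier A) \<zero>\<^bsub>A\<^esub> (\<oplus>\<^bsub>A\<^esub>) (\<otimes>\<^bsub>A\<^esub>)"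

definition linear_maps ::
  "('a, 'r) ring_scheme \<Rightarrow> ('a, 'm) module \<Rightarrow> ('a, 'n) module \<Rightarrow> ('m \<Rightarrow> 'n) set" where
  "linear_maps A M N =
     {f \<in> carrier M \<rightarrow> carrier N.
        (\<forall>x\<in>carrier M. \<forall>y\<in>carrier M. f (x \<oplus>\<^bsub>M\<^esub> y) = f x \<oplus>\<^bsub>N\<^esub> f y) \<and>
        (\<forall>a\<in>carrier A. \<forall>x\<in>carrier M. f (a \<odot>\<^bsub>M\<^esub> x) = a \<odot>\<^bsub>N\<^esub> f x)}"

definition submodule_span ::
  "('a, 'r) ring_scheme \<Rightarrow> ('a, 'm) module \<Rightarrow> 'm set \<Rightarrow> 'm set" where
  "submodule_span A M S = \<Inter> {N. submodule N A M \<and> S \<subseteq> N}"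

definition quot_module :: "('a, 'm) module \<Rightarrow> 'm set \<Rightarrow> ('a, 'm set) module" where
  "quot_module M K =
     mk_module (a_rcosets\<^bsub>M\<^esub> K) K (set_add M) (\<lambda>a X. \<Union>x\<in>X. K +>\<^bsub>M\<^esub> (a \<odot>\<^bsub>M\<^esub> x))"

text \<open>
  The map into \<open>N / K\<close> induced by \<open>f\<close> on a quotient of the source: if \<open>f\<close> sends the submodule
  divided out in the source into \<open>K\<close>, then the cosets in the union below all coincide.
\<close>

definition quot_map :: "('a, 'n) module \<Rightarrow> 'n set \<Rightarrow> ('m \<Rightarrow> 'n) \<Rightarrow> 'm set \<Rightarrow> 'n set" where
  "quot_map N K f X = (\<Union>x\<in>X. K +>\<^bsub>N\<^esub> f x)"


section \<open>Tensor products\<close>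

definition free_module :: "('a, 'r) ring_scheme \<Rightarrow> 's set \<Rightarrow> ('a, 's \<Rightarrow> 'a) module" where
  "free_module A S =
     mk_module
       {\<phi>. (\<forall>x. \<phi> x \<in> carrier A) \<and> (\<forall>x. x \<notin> S \<longrightarrow> \<phi> x = \<zero>\<^bsub>A\<^esub>) \<and> finite {x. \<phi> x \<noteq> \<zero>\<^bsub>A\<^esub>}}
       (\<lambda>_. \<zero>\<^bsub>A\<^esub>)
       (\<lambda>\<phi> \<psi> x. \<phi> x \<oplus>\<^bsub>A\<^esub> \<psi> x)
       (\<lambda>a \<phi> x. a \<otimes>\<^bsub>A\<^esub> \<phi> x)"

definition free_basis :: "('a, 'r) ring_scheme \<Rightarrow> 's \<Rightarrow> 's \<Rightarrow> 'a" where
  "free_basis A x = (\<lambda>y. if y = x then \<one>\<^bsub>A\<^esub> else \<zero>\<^bsub>A\<^esub>)"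

text \<open>The linear map of free modules that sends the basis element of \<open>x\<close> to that of \<open>h x\<close>.\<close>

definition free_map ::
  "('a, 'r) ring_scheme \<Rightarrow> ('s \<Rightarrow> 't) \<Rightarrow> ('s \<Rightarrow> 'a) \<Rightarrow> 't \<Rightarrow> 'a" where
  "free_map A h \<phi> = (\<lambda>y. \<Oplus>\<^bsub>A\<^esub>x\<in>{x. \<phi> x \<noteq> \<zero>\<^bsub>A\<^esub> \<and> h x = y}. \<phi> x)"

definition tensor_free ::
  "('a, 'r) ring_scheme \<Rightarrow> ('a, 'm) module \<Rightarrow> ('a, 'n) module \<Rightarrow> ('a, 'm \<times> 'n \<Rightarrow> 'a) module" where
  "tensor_free A M N = free_module A (carrier M \<times> carrier N)"

definition tensor_relations ::
  "('a, 'r) ring_scheme \<Rightarrow> ('a, 'm) module \<Rightarrow> ('a, 'n) module \<Rightarrow> ('m \<times> 'n \<Rightarrow> 'a) set" where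
  "tensor_relations A M N =
     (let F = tensor_free A M N; e = free_basis A in
      submodule_span A F
       ({e (x \<oplus>\<^bsub>M\<^esub> x', y) \<ominus>\<^bsub>F\<^esub> (e (x, y) \<oplus>\<^bsub>F\<^esub> e (x', y)) | x x' y.
           x \<in> carrier M \<and> x' \<in> carrier M \<and> y \<in> carrier N} \<union>
        {e (x, y \<oplus>\<^bsub>N\<^esub> y') \<ominus>\<^bsub>F\<^esub> (e (x, y) \<oplus>\<^bsub>F\<^esub> e (x, y')) | x y y'.
           x \<in> carrier M \<and> y \<in> carrier N \<and> y' \<in> carrier N} \<union>
        {e (a \<odot>\<^bsub>M\<^esub> x, y) \<ominus>\<^bsub>F\<^esub> (a \<odot>\<^bsub>F\<^esub> e (x, y)) | a x y.
           a \<in> carrier A \<and> x \<in> carrier M \<and> y \<in> carrier N} \<union>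
        {e (x, a \<odot>\<^bsub>N\<^esub> y) \<ominus>\<^bsub>F\<^esub> (a \<odot>\<^bsub>F\<^esub> e (x, y)) | a x y.
           a \<in> carrier A \<and> x \<in> carrier M \<and> y \<in> carrier N}))"

definition tensor_module ::
  "('a, 'r) ring_scheme \<Rightarrow> ('a, 'm) module \<Rightarrow> ('a, 'n) module
     \<Rightarrow> ('a, ('m \<times> 'n \<Rightarrow> 'a) set) module" where
  "tensor_module A M N = quot_module (tensor_free A M N) (tensor_relations A M N)"

text \<open>The map \<open>id \<otimes> g\<close> from \<open>T \<otimes> M\<close> to \<open>T \<otimes> N\<close>, for a linear map \<open>g\<close> from \<open>M\<close> to \<open>N\<close>.\<close>

definition tensor_map ::
  "('a, 'r) ring_scheme \<Rightarrow> ('a, 't) module \<Rightarrow> ('a, 'n) module \<Rightarrow> ('m \<Rightarrow> 'n)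
     \<Rightarrow> ('t \<times> 'm \<Rightarrow> 'a) set \<Rightarrow> ('t \<times> 'n \<Rightarrow> 'a) set" where
  "tensor_map A T N g =
     quot_map (tensor_free A T N) (tensor_relations A T N) (free_map A (\<lambda>(t, x). (t, g x)))"


section \<open>Adic completion of modules\<close>

primrec ideal_power :: "('a, 'r) ring_scheme \<Rightarrow> 'a set \<Rightarrow> nat \<Rightarrow> 'a set" where
  "ideal_power A I 0 = carrier A"
| "ideal_power A I (Suc n) = ideal_prod A I (ideal_power A I n)"

definition adic_submodule ::
  "('a, 'r) ring_scheme \<Rightarrow> 'a set \<Rightarrow> ('a, 'm) module \<Rightarrow> nat \<Rightarrow> 'm set" where
  "adic_submodule A I M n =
     submodule_span A M {a \<odot>\<^bsub>M\<^esub> x | a x. a \<in> ideal_power A I n \<and> x \<in> carrier M}"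

text \<open>
  The inverse limit of the modules \<open>M / I^n M\<close> as the module of compatible sequences of cosets.
  The transition map from level \<open>n + 1\<close> to level \<open>n\<close> is induced by the identity of \<open>M\<close>.
\<close>

definition completion ::
  "('a, 'r) ring_scheme \<Rightarrow> 'a set \<Rightarrow> ('a, 'm) module \<Rightarrow> ('a, nat \<Rightarrow> 'm set) module" where
  "completion A I M =
     (let K = adic_submodule A I M; L = (\<lambda>n. quot_module M (K n)) in
      mk_module
        {s. (\<forall>n. s n \<in> carrier (L n)) \<and> (\<forall>n. quot_map M (K n) id (s (Suc n)) = s n)}
        (\<lambda>n. \<zero>\<^bsub>L n\<^esub>)
        (\<lambda>s t n. s n \<oplus>\<^bsub>L n\<^esub> t n)
        (\<lambda>a s n. a \<odot>\<^bsub>L n\<^esub> s n))"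

definition completion_map ::
  "('a, 'r) ring_scheme \<Rightarrow> 'a set \<Rightarrow> ('a, 'n) module \<Rightarrow> ('m \<Rightarrow> 'n)
     \<Rightarrow> (nat \<Rightarrow> 'm set) \<Rightarrow> nat \<Rightarrow> 'n set" where
  "completion_map A I N f s = (\<lambda>n. quot_map N (adic_submodule A I N n) f (s n))"

definition completion_unit ::
  "('a, 'r) ring_scheme \<Rightarrow> 'a set \<Rightarrow> ('a, 'm) module \<Rightarrow> 'm \<Rightarrow> nat \<Rightarrow> 'm set" where
  "completion_unit A I M x = (\<lambda>n. adic_submodule A I M n +>\<^bsub>M\<^esub> x)"

definition adically_complete ::
  "('a, 'r) ring_scheme \<Rightarrow> 'a set \<Rightarrow> ('a, 'm) module \<Rightarrow> bool" where
  "adically_complete A I M \<longleftrightarrow>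
     bij_betw (completion_unit A I M) (carrier M) (carrier (completion A I M))"


section \<open>Complexes\<close>

record ('a, 'm) cochain_complex =
  obj :: "int \<Rightarrow> ('a, 'm) module"
  diff :: "int \<Rightarrow> 'm \<Rightarrow> 'm"

definition is_complex :: "('a, 'r) ring_scheme \<Rightarrow> ('a, 'm) cochain_complex \<Rightarrow> bool" where
  "is_complex A X \<longleftrightarrow>
     (\<forall>i. module A (obj X i)) \<and>
     (\<forall>i. diff X i \<in> linear_maps A (obj X i) (obj X (i + 1))) \<and>
     (\<forall>i. \<forall>x\<in>carrier (obj X i). diff X (i + 1) (diff X i x) = \<zero>\<^bsub>obj X (i + 1 + 1)\<^esub>)"

definition cocycles :: "('a, 'm) cochain_complex \<Rightarrow> int \<Rightarrow> 'm set" where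
  "cocycles X i = {x \<in> carrier (obj X i). diff X i x = \<zero>\<^bsub>obj X (i + 1)\<^esub>}"

definition coboundaries :: "('a, 'm) cochain_complex \<Rightarrow> int \<Rightarrow> 'm set" where
  "coboundaries X i = diff X (i - 1) ` carrier (obj X (i - 1))"

definition cohomology :: "('a, 'm) cochain_complex \<Rightarrow> int \<Rightarrow> ('a, 'm set) module" where
  "cohomology X i = quot_module (obj X i \<lparr>carrier := cocycles X i\<rparr>) (coboundaries X i)"

definition acyclic_complex :: "('a, 'm) cochain_complex \<Rightarrow> bool" where
  "acyclic_complex X \<longleftrightarrow> (\<forall>i. carrier (cohomology X i) = {\<zero>\<^bsub>cohomology X i\<^esub>})"

definition cohomology_bounded_above :: "('a, 'm) cochain_complex \<Rightarrow> bool" where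
  "cohomology_bounded_above X \<longleftrightarrow>
     (\<exists>n. \<forall>i>n. carrier (cohomology X i) = {\<zero>\<^bsub>cohomology X i\<^esub>})"

definition chain_map ::
  "('a, 'r) ring_scheme \<Rightarrow> ('a, 'm) cochain_complex \<Rightarrow> ('a, 'n) cochain_complex
     \<Rightarrow> (int \<Rightarrow> 'm \<Rightarrow> 'n) \<Rightarrow> bool" where
  "chain_map A X Y f \<longleftrightarrow>
     (\<forall>i. f i \<in> linear_maps A (obj X i) (obj Y i)) \<and>
     (\<forall>i. \<forall>x\<in>carrier (obj X i). f (i + 1) (diff X i x) = diff Y i (f i x))"

definition homotopic ::
  "('a, 'r) ring_scheme \<Rightarrow> ('a, 'm) cochain_complex \<Rightarrow> ('a, 'n) cochain_complex
     \<Rightarrow> (int \<Rightarrow> 'm \<Rightarrow> 'n) \<Rightarrow> (int \<Rightarrow> 'm \<Rightarrow> 'n) \<Rightarrow> bool" where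
  "homotopic A X Y f g \<longleftrightarrow>
     (\<exists>h. (\<forall>i. h i \<in> linear_maps A (obj X i) (obj Y (i - 1))) \<and>
          (\<forall>i. \<forall>x\<in>carrier (obj X i).
             f i x = g i x \<oplus>\<^bsub>obj Y i\<^esub> (diff Y (i - 1) (h i x) \<oplus>\<^bsub>obj Y i\<^esub> h (i + 1) (diff X i x))))"

definition quasi_iso ::
  "('a, 'r) ring_scheme \<Rightarrow> ('a, 'm) cochain_complex \<Rightarrow> ('a, 'n) cochain_complex
     \<Rightarrow> (int \<Rightarrow> 'm \<Rightarrow> 'n) \<Rightarrow> bool" where
  "quasi_iso A X Y f \<longleftrightarrow>
     chain_map A X Y f \<and>
     (\<forall>i. bij_betw (quot_map (obj Y i) (coboundaries Y i) (f i))
            (carrier (cohomology X i)) (carrier (cohomology Y i)))"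

definition zero_complex :: "('a, 'm) cochain_complex" where
  "zero_complex =
     \<lparr>obj = (\<lambda>_. mk_module {undefined} undefined (\<lambda>_ _. undefined) (\<lambda>_ _. undefined)),
      diff = (\<lambda>_ _. undefined)\<rparr>"

text \<open>
  In degree \<open>n\<close> the Hom complex consists of the families of linear maps from \<open>X^i\<close> to
  \<open>Y^(i + n)\<close>; its differential is \<open>\<phi> \<mapsto> d \<phi> - (-1)^n \<phi> d\<close>. Maps are extensional so that equality
  in the Hom module is equality on the carriers.
\<close>

definition hom_module ::
  "('a, 'r) ring_scheme \<Rightarrow> ('a, 'm) cochain_complex \<Rightarrow> ('a, 'n) cochain_complex \<Rightarrow> int
     \<Rightarrow> ('a, int \<Rightarrow> 'm \<Rightarrow> 'n) module" where
  "hom_module A X Y n =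
     mk_module
       {\<phi>. \<forall>i. \<phi> i \<in> linear_maps A (obj X i) (obj Y (i + n)) \<inter> extensional (carrier (obj X i))}
       (\<lambda>i. \<lambda>x\<in>carrier (obj X i). \<zero>\<^bsub>obj Y (i + n)\<^esub>)
       (\<lambda>\<phi> \<psi> i. \<lambda>x\<in>carrier (obj X i). \<phi> i x \<oplus>\<^bsub>obj Y (i + n)\<^esub> \<psi> i x)
       (\<lambda>a \<phi> i. \<lambda>x\<in>carrier (obj X i). a \<odot>\<^bsub>obj Y (i + n)\<^esub> \<phi> i x)"

definition hom_complex ::
  "('a, 'r) ring_scheme \<Rightarrow> ('a, 'm) cochain_complex \<Rightarrow> ('a, 'n) cochain_complex
     \<Rightarrow> ('a, int \<Rightarrow> 'm \<Rightarrow> 'n) cochain_complex" where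
  "hom_complex A X Y =
     \<lparr>obj = hom_module A X Y,
      diff = (\<lambda>n \<phi> i. \<lambda>x\<in>carrier (obj X i).
        if even n
        then diff Y (i + n) (\<phi> i x) \<ominus>\<^bsub>obj Y (i + n + 1)\<^esub> \<phi> (i + 1) (diff X i x)
        else diff Y (i + n) (\<phi> i x) \<oplus>\<^bsub>obj Y (i + n + 1)\<^esub> \<phi> (i + 1) (diff X i x))\<rparr>"

definition tensor_complex ::
  "('a, 'r) ring_scheme \<Rightarrow> ('a, 't) module \<Rightarrow> ('a, 'm) cochain_complex
     \<Rightarrow> ('a, ('t \<times> 'm \<Rightarrow> 'a) set) cochain_complex" where
  "tensor_complex A T X =
     \<lparr>obj = (\<lambda>i. tensor_module A T (obj X i)),
      diff = (\<lambda>i. tensor_map A T (obj X (i + 1)) (diff X i))\<rparr>"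

definition completion_complex ::
  "('a, 'r) ring_scheme \<Rightarrow> 'a set \<Rightarrow> ('a, 'm) cochain_complex
     \<Rightarrow> ('a, nat \<Rightarrow> 'm set) cochain_complex" where
  "completion_complex A I X =
     \<lparr>obj = (\<lambda>i. completion A I (obj X i)),
      diff = (\<lambda>i. completion_map A I (obj X (i + 1)) (diff X i))\<rparr>"


section \<open>Isomorphisms in the derived category\<close>

text \<open>
  A morphism from \<open>Y\<close> to \<open>X\<close> in the derived category is a fraction \<open>g s\<^sup>-\<^sup>1\<close> with a quasi-isomorphism
  \<open>s : R \<rightarrow> Y\<close> and a chain map \<open>g : R \<rightarrow> X\<close>. A chain map \<open>f : X \<rightarrow> Y\<close> represents an isomorphism if
  some such fraction is inverse to it:

  \<^item> \<open>f g s\<^sup>-\<^sup>1 = id\<close> means that \<open>f g\<close> and \<open>s\<close> become homotopic after composition with some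
    quasi-isomorphism \<open>t\<close> into \<open>R\<close>.
  \<^item> The composite \<open>g s\<^sup>-\<^sup>1 f\<close> is formed by completing \<open>s\<close> and \<open>f\<close> to a square \<open>s h \<simeq> f u\<close> with a
    quasi-isomorphism \<open>u\<close>; it is the fraction \<open>(g h) u\<^sup>-\<^sup>1\<close>, and it equals \<open>id\<close> if \<open>g h \<simeq> u\<close> (for
    a suitable choice of the square).

  Letting the auxiliary complexes have the carrier type of \<open>X\<close> is no restriction: if \<open>f\<close> is a
  quasi-isomorphism, then \<open>R = X\<close>, \<open>s = f\<close>, \<open>g = id\<close> is an inverse.
\<close>

definition derived_isomorphism ::
  "('a, 'r) ring_scheme \<Rightarrow> ('a, 'm) cochain_complex \<Rightarrow> ('a, 'n) cochain_complex
     \<Rightarrow> (int \<Rightarrow> 'm \<Rightarrow> 'n) \<Rightarrow> bool" where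
  "derived_isomorphism A X Y f \<longleftrightarrow>
     chain_map A X Y f \<and>
     (\<exists>(R :: ('a, 'm) cochain_complex) s g.
        is_complex A R \<and> quasi_iso A R Y s \<and> chain_map A R X g \<and>
        (\<exists>(T :: ('a, 'm) cochain_complex) t.
           is_complex A T \<and> quasi_iso A T R t \<and>
           homotopic A T Y (\<lambda>i x. f i (g i (t i x))) (\<lambda>i x. s i (t i x))) \<and>
        (\<exists>(U :: ('a, 'm) cochain_complex) u h.
           is_complex A U \<and> quasi_iso A U X u \<and> chain_map A U R h \<and>
           homotopic A U Y (\<lambda>i x. s i (h i x)) (\<lambda>i x. f i (u i x)) \<and>
           homotopic A U X (\<lambda>i x. g i (h i x)) u))"

definition derived_zero :: "('a, 'r) ring_scheme \<Rightarrow> ('a, 'm) cochain_complex \<Rightarrow> bool" where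
  "derived_zero A X \<longleftrightarrow>
     derived_isomorphism A X (zero_complex :: ('a, 'm) cochain_complex)
       (\<lambda>i x. \<zero>\<^bsub>obj (zero_complex :: ('a, 'm) cochain_complex) i\<^esub>)"


section \<open>K-projective resolutions and derived functors\<close>

text \<open>
  Test complexes are taken with the carrier type of \<open>P\<close>. If this type is infinite and at least as
  large as \<open>A\<close>, then acyclicity of the Hom complexes into all acyclic complexes, of any size,
  follows, since every chain map from \<open>P\<close> to an acyclic complex then factors through an acyclic
  subcomplex that is no larger than the type.
\<close>

definition K_projective :: "('a, 'r) ring_scheme \<Rightarrow> ('a, 'm) cochain_complex \<Rightarrow> bool" where
  "K_projective A P \<longleftrightarrow>
     is_complex A P \<and>
     (\<forall>N :: ('a, 'm) cochain_complex.
        is_complex A N \<and> acyclic_complex N \<longrightarrow> acyclic_complex (hom_complex A P N))"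

text \<open>
  Resolutions of complexes with carrier type \<open>'m\<close> have their carriers in the type below. It is
  infinite and at least as large as \<open>'a\<close> and \<open>'m\<close>, so it contains copies of the free modules on
  subsets of itself, and every complex has a K-projective resolution there. As derived functors do
  not depend on the resolution, it does not matter which one is used.
\<close>

type_synonym ('a, 'm) resolution_carrier = "('a + 'm) list"

definition K_projective_resolution ::
  "('a, 'r) ring_scheme \<Rightarrow> ('a, 'm) cochain_complex
     \<Rightarrow> ('a, ('a, 'm) resolution_carrier) cochain_complex
     \<Rightarrow> (int \<Rightarrow> ('a, 'm) resolution_carrier \<Rightarrow> 'm) \<Rightarrow> bool" where
  "K_projective_resolution A M Q q \<longleftrightarrow> K_projective A Q \<and> quasi_iso A Q M q"

text \<open>The complexes that represent the derived tensor product of a module \<open>T\<close> with \<open>M\<close>.\<close>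

definition derived_tensor ::
  "('a, 'r) ring_scheme \<Rightarrow> ('a, 't) module \<Rightarrow> ('a, 'm) cochain_complex
     \<Rightarrow> ('a, ('t \<times> ('a, 'm) resolution_carrier \<Rightarrow> 'a) set) cochain_complex set" where
  "derived_tensor A T M = {tensor_complex A T Q | Q q. K_projective_resolution A M Q q}"

definition cohomologically_complete ::
  "('a, 'r) ring_scheme \<Rightarrow> 'a set \<Rightarrow> ('a, 'm) cochain_complex \<Rightarrow> bool" where
  "cohomologically_complete A I M \<longleftrightarrow>
     (\<exists>Q q. K_projective_resolution A M Q q \<and>
        derived_isomorphism A Q (completion_complex A I Q) (\<lambda>i. completion_unit A I (obj Q i)))"

definition D_minus_com ::
  "('a, 'r) ring_scheme \<Rightarrow> 'a set \<Rightarrow> ('a, 'm) cochain_complex set" where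
  "D_minus_com A I =
     {M. is_complex A M \<and> cohomology_bounded_above M \<and> cohomologically_complete A I M}"

end

theory Submission
  imports Defs
begin

text \<open>
  It is enough to show that \<open>H\<^bsup>n\<^esup>(M) = 0\<close> if \<open>H\<^bsup>i\<^esup>(M) = 0\<close> for all \<open>i > n\<close>. A K-projective resolution
  \<open>P\<close> of \<open>M\<close> then has a linear map from \<open>P\<^bsup>n\<^esup>\<close> to \<open>H\<^bsup>n\<^esup>(P)\<close> that kills the coboundaries and extends the
  projection of the cocycles. It induces a map from \<open>H\<^bsup>n\<^esup>(A\<^sub>0 \<otimes> P) = 0\<close> to \<open>H\<^bsup>n\<^esup>(P) / I H\<^bsup>n\<^esup>(P)\<close> whose
  image contains the class of every cocycle, so \<open>H\<^bsup>n\<^esup>(M) = I H\<^bsup>n\<^esup>(M)\<close>. For a resolution \<open>Q\<close> that is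
  quasi-isomorphic to its completion, this equality, applied again and again, makes every
  \<open>n\<close>-cocycle of \<open>Q\<close> a coboundary in the completion, hence in \<open>Q\<close>.
\<close>

section \<open>Linear maps and quotient modules\<close>

text \<open>The usual argument replaces P by a resolution in degrees at most n and computes H^n(A_0
  \<otimes> P) as A_0 \<otimes> H^n(P) by right exactness. Here P is whatever K-projective
  resolution the hypothesis provides and may be nonzero in every degree; the retraction of P^n onto
  H^n(P), which comes from K-projectivity, takes the place of the truncation.

  H^n(M) need be neither finitely generated nor separated, so H^n = I H^n alone does not make it
  vanish. The iteration is therefore carried out on cochains: the corrections, with the k-th one in
  I^k Q^(n-1), form a series that converges in the completion of Q^(n-1), and injectivity of the
  unit on cohomology brings the result back to Q.

  The resolution P with acyclic tensor product and the resolution Q used for completion are given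
  independently. Instead of comparing them, the proof carries the inclusion of Z^n in B^n + I Z^n,
  which says H^n = I H^n, along P \<rightarrow> M \<leftarrow> Q.\<close>

lemma mk_module_simps [simp]:
  "carrier (mk_module C z p s) = C" "ring.zero (mk_module C z p s) = z"
  "ring.add (mk_module C z p s) = p" "smult (mk_module C z p s) = s"
  by (simp_all add: mk_module_def)

lemma linear_mapsI:
  assumes "\<And>x. x \<in> carrier M \<Longrightarrow> f x \<in> carrier N"
    and "\<And>x y. x \<in> carrier M \<Longrightarrow> y \<in> carrier M \<Longrightarrow> f (x \<oplus>\<^bsub>M\<^esub> y) = f x \<oplus>\<^bsub>N\<^esub> f y"
    and "\<And>a x. a \<in> carrier A \<Longrightarrow> x \<in> carrier M \<Longrightarrow> f (a \<odot>\<^bsub>M\<^esub> x) = a \<odot>\<^bsub>N\<^esub> f x"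
  shows "f \<in> linear_maps A M N"
  using assms by (auto simp: linear_maps_def)

lemma linear_maps_closed: "f \<in> linear_maps A M N \<Longrightarrow> x \<in> carrier M \<Longrightarrow> f x \<in> carrier N"
  and linear_maps_add: "f \<in> linear_maps A M N \<Longrightarrow> x \<in> carrier M \<Longrightarrow> y \<in> carrier M
    \<Longrightarrow> f (x \<oplus>\<^bsub>M\<^esub> y) = f x \<oplus>\<^bsub>N\<^esub> f y"
  and linear_maps_smult: "f \<in> linear_maps A M N \<Longrightarrow> a \<in> carrier A \<Longrightarrow> x \<in> carrier M
    \<Longrightarrow> f (a \<odot>\<^bsub>M\<^esub> x) = a \<odot>\<^bsub>N\<^esub> f x"
  by (auto simp: linear_maps_def)

lemma linear_maps_comp:
  "f \<in> linear_maps A L M \<Longrightarrow> g \<in> linear_maps A M N \<Longrightarrow> (\<lambda>x. g (f x)) \<in> linear_maps A L N"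
  by (rule linear_mapsI) (simp_all add: linear_maps_closed linear_maps_add linear_maps_smult)

lemma linear_maps_id: "id \<in> linear_maps A M M"
  by (auto simp: linear_maps_def)

lemma linear_maps_zero:
  assumes "module A M" "module A N" "f \<in> linear_maps A M N"
  shows "f \<zero>\<^bsub>M\<^esub> = \<zero>\<^bsub>N\<^esub>"
proof -
  interpret M: module A M by fact
  interpret N: module A N by fact
  have "f (\<zero>\<^bsub>A\<^esub> \<odot>\<^bsub>M\<^esub> \<zero>\<^bsub>M\<^esub>) = \<zero>\<^bsub>A\<^esub> \<odot>\<^bsub>N\<^esub> f \<zero>\<^bsub>M\<^esub>"
    by (rule linear_maps_smult[OF assms(3)]) auto
  with linear_maps_closed[OF assms(3)] show ?thesis by simp
qed

lemma linear_maps_minus: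
  assumes "module A M" "module A N" "f \<in> linear_maps A M N" "x \<in> carrier M"
  shows "f (\<ominus>\<^bsub>M\<^esub> x) = \<ominus>\<^bsub>N\<^esub> f x"
proof -
  interpret M: module A M by fact
  interpret N: module A N by fact
  have "f (\<ominus>\<^bsub>M\<^esub> x) \<oplus>\<^bsub>N\<^esub> f x = \<zero>\<^bsub>N\<^esub>"
    using assms(4) linear_maps_add[OF assms(3), of "\<ominus>\<^bsub>M\<^esub> x" x]
    by (simp add: M.l_neg linear_maps_zero[OF assms(1-3)])
  then show ?thesis
    using assms(4) linear_maps_closed[OF assms(3)] by (metis M.a_inv_closed N.minus_equality)
qed

lemma linear_maps_diff:
  assumes "module A M" "module A N" "f \<in> linear_maps A M N" "x \<in> carrier M" "y \<in> carrier M"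
  shows "f (x \<ominus>\<^bsub>M\<^esub> y) = f x \<ominus>\<^bsub>N\<^esub> f y"
proof -
  interpret M: module A M by fact
  show ?thesis using assms(4,5)
    by (simp add: a_minus_def linear_maps_add[OF assms(3)] linear_maps_minus[OF assms(1-3)])
qed

section \<open>Submodules and spans\<close>

lemma submoduleI':
  assumes "module A M" "K \<subseteq> carrier M" "\<zero>\<^bsub>M\<^esub> \<in> K"
    and "\<And>x y. x \<in> K \<Longrightarrow> y \<in> K \<Longrightarrow> x \<oplus>\<^bsub>M\<^esub> y \<in> K"
    and "\<And>a x. a \<in> carrier A \<Longrightarrow> x \<in> K \<Longrightarrow> a \<odot>\<^bsub>M\<^esub> x \<in> K"
  shows "submodule K A M"
proof -
  interpret M: module A M by fact
  have "\<ominus>\<^bsub>M\<^esub> x \<in> K" if "x \<in> K" for x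
    using assms(5)[of "\<ominus>\<^bsub>A\<^esub> \<one>\<^bsub>A\<^esub>" x] that assms(2) M.smult_l_minus[of "\<one>\<^bsub>A\<^esub>" x] by auto
  with assms show ?thesis by (intro M.submoduleI) auto
qed

lemma submodule_subset: "submodule K A M \<Longrightarrow> x \<in> K \<Longrightarrow> x \<in> carrier M"
  using subgroup.subset[of K "add_monoid M"] by (auto simp: submodule_def)

lemma submodule_zero: "submodule K A M \<Longrightarrow> \<zero>\<^bsub>M\<^esub> \<in> K"
  using subgroup.one_closed[of K "add_monoid M"] by (auto simp: submodule_def)

lemma submodule_add: "submodule K A M \<Longrightarrow> x \<in> K \<Longrightarrow> y \<in> K \<Longrightarrow> x \<oplus>\<^bsub>M\<^esub> y \<in> K"
  using subgroup.m_closed[of K "add_monoid M"] by (auto simp: submodule_def)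

lemma submodule_minus: "submodule K A M \<Longrightarrow> x \<in> K \<Longrightarrow> \<ominus>\<^bsub>M\<^esub> x \<in> K"
  using subgroup.m_inv_closed[of K "add_monoid M"] by (auto simp: submodule_def a_inv_def)

lemma submodule_diff: "submodule K A M \<Longrightarrow> x \<in> K \<Longrightarrow> y \<in> K \<Longrightarrow> x \<ominus>\<^bsub>M\<^esub> y \<in> K"
  by (simp add: a_minus_def submodule_add submodule_minus)

lemma submodule_smult: "submodule K A M \<Longrightarrow> a \<in> carrier A \<Longrightarrow> x \<in> K \<Longrightarrow> a \<odot>\<^bsub>M\<^esub> x \<in> K"
  using submodule.smult_closed by fastforce

text \<open>Spans are defined as intersections, so their elements come without an expression in the
  generators. A claim about all of them is proved by showing that the elements with the property
  form a submodule that contains the generators; preimages under linear maps are the usual source of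
  such submodules.\<close>

lemma submodule_vimage:
  assumes "module A M" "module A N" "f \<in> linear_maps A M N" "submodule K A N"
  shows "submodule {x \<in> carrier M. f x \<in> K} A M"
proof -
  interpret M: module A M by fact
  show ?thesis
    using linear_maps_zero[OF assms(1-3)] submodule_zero[OF assms(4)]
    by (intro submoduleI' assms(1))
      (auto simp: linear_maps_add[OF assms(3)] linear_maps_smult[OF assms(3)]
        intro: submodule_add[OF assms(4)] submodule_smult[OF assms(4)])
qed

lemma submodule_image:
  assumes "module A M" "module A N" "f \<in> linear_maps A M N" "submodule K A M"
  shows "submodule (f ` K) A N"
proof -
  interpret M: module A M by fact
  interpret N: module A N by fact
  note K = submodule_subset[OF assms(4)]
  show ?thesis
  proof (rule submoduleI'[OF assms(2)])
    show "f ` K \<subseteq> carrier N" using K linear_maps_closed[OF assms(3)] by auto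
    show "\<zero>\<^bsub>N\<^esub> \<in> f ` K"
      using linear_maps_zero[OF assms(1-3)] submodule_zero[OF assms(4)] by force
    show "u \<oplus>\<^bsub>N\<^esub> v \<in> f ` K" if "u \<in> f ` K" "v \<in> f ` K" for u v
      using that K submodule_add[OF assms(4)]
      by (auto simp flip: linear_maps_add[OF assms(3)])
    show "a \<odot>\<^bsub>N\<^esub> u \<in> f ` K" if "a \<in> carrier A" "u \<in> f ` K" for a u
      using that K submodule_smult[OF assms(4)]
      by (auto simp flip: linear_maps_smult[OF assms(3)])
  qed
qed

lemma submodule_zero_module: "module A M \<Longrightarrow> submodule {\<zero>\<^bsub>M\<^esub>} A M"
proof -
  assume "module A M"
  then interpret M: module A M .
  show ?thesis by (rule submoduleI') (auto intro: \<open>module A M\<close>)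
qed

lemma submodule_kernel:
  assumes "module A M" "module A N" "f \<in> linear_maps A M N"
  shows "submodule {x \<in> carrier M. f x = \<zero>\<^bsub>N\<^esub>} A M"
  using submodule_vimage[OF assms submodule_zero_module[OF assms(2)]] by simp

text \<open>This is the tool for splitting an element of a span with two kinds of generators: the
  sums form a submodule, and it contains both kinds.\<close>

lemma submodule_sum:
  assumes "module A M" "submodule K A M" "submodule L A M"
  shows "submodule {x \<oplus>\<^bsub>M\<^esub> y | x y. x \<in> K \<and> y \<in> L} A M"
proof -
  interpret M: module A M by fact
  note K = submodule_subset[OF assms(2)] submodule_subset[OF assms(3)]
  show ?thesis
  proof (rule submoduleI'[OF assms(1)])
    show "{x \<oplus>\<^bsub>M\<^esub> y | x y. x \<in> K \<and> y \<in> L} \<subseteq> carrier M" using K by auto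
    show "\<zero>\<^bsub>M\<^esub> \<in> {x \<oplus>\<^bsub>M\<^esub> y | x y. x \<in> K \<and> y \<in> L}"
      using submodule_zero[OF assms(2)] submodule_zero[OF assms(3)] M.l_zero[OF M.zero_closed]
      by force
  next
    fix u v assume "u \<in> {x \<oplus>\<^bsub>M\<^esub> y | x y. x \<in> K \<and> y \<in> L}" "v \<in> {x \<oplus>\<^bsub>M\<^esub> y | x y. x \<in> K \<and> y \<in> L}"
    then obtain x y x' y' where *: "u = x \<oplus>\<^bsub>M\<^esub> y" "v = x' \<oplus>\<^bsub>M\<^esub> y'" "x \<in> K" "y \<in> L" "x' \<in> K" "y' \<in> L"
      by auto
    with K have "u \<oplus>\<^bsub>M\<^esub> v = (x \<oplus>\<^bsub>M\<^esub> x') \<oplus>\<^bsub>M\<^esub> (y \<oplus>\<^bsub>M\<^esub> y')" by (simp add: M.a_ac)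
    with * show "u \<oplus>\<^bsub>M\<^esub> v \<in> {x \<oplus>\<^bsub>M\<^esub> y | x y. x \<in> K \<and> y \<in> L}"
      using submodule_add[OF assms(2)] submodule_add[OF assms(3)] by blast
  next
    fix a u assume a: "a \<in> carrier A" and "u \<in> {x \<oplus>\<^bsub>M\<^esub> y | x y. x \<in> K \<and> y \<in> L}"
    then obtain x y where xy: "u = x \<oplus>\<^bsub>M\<^esub> y" "x \<in> K" "y \<in> L" by auto
    with a K have "a \<odot>\<^bsub>M\<^esub> u = a \<odot>\<^bsub>M\<^esub> x \<oplus>\<^bsub>M\<^esub> a \<odot>\<^bsub>M\<^esub> y" by (simp add: M.smult_r_distr)
    moreover have "a \<odot>\<^bsub>M\<^esub> x \<in> K" "a \<odot>\<^bsub>M\<^esub> y \<in> L"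
      using a xy submodule_smult[OF assms(2)] submodule_smult[OF assms(3)] by auto
    ultimately show "a \<odot>\<^bsub>M\<^esub> u \<in> {x \<oplus>\<^bsub>M\<^esub> y | x y. x \<in> K \<and> y \<in> L}" by blast
  qed
qed

lemma submodule_span_least: "submodule N A M \<Longrightarrow> S \<subseteq> N \<Longrightarrow> submodule_span A M S \<subseteq> N"
  by (auto simp: submodule_span_def)

lemma submodule_span_superset: "x \<in> S \<Longrightarrow> x \<in> submodule_span A M S"
  by (auto simp: submodule_span_def)

lemma submodule_span_mono: "S \<subseteq> T \<Longrightarrow> submodule_span A M S \<subseteq> submodule_span A M T"
  by (auto simp: submodule_span_def)

lemma submodule_span_submodule:
  assumes "module A M" "S \<subseteq> carrier M"
  shows "submodule (submodule_span A M S) A M"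
proof (rule submoduleI'[OF assms(1)])
  show "submodule_span A M S \<subseteq> carrier M"
    by (rule submodule_span_least[OF module.carrier_is_submodule[OF assms(1)] assms(2)])
qed (auto simp: submodule_span_def intro: submodule_zero submodule_add submodule_smult)

lemma submodule_span_image:
  assumes "module A M" "module A N" "f \<in> linear_maps A M N" "S \<subseteq> carrier M" "T \<subseteq> carrier N"
    and "\<And>x. x \<in> S \<Longrightarrow> f x \<in> submodule_span A N T" and "x \<in> submodule_span A M S"
  shows "f x \<in> submodule_span A N T"
proof -
  have "submodule_span A M S \<subseteq> {x \<in> carrier M. f x \<in> submodule_span A N T}"
    by (rule submodule_span_least[OF submodule_vimage[OF assms(1-3)
          submodule_span_submodule[OF assms(2,5)]]]) (use assms(4,6) in auto)
  with assms(7) show ?thesis by auto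
qed

lemma regular_module_module:
  assumes "cring A" shows "module A (regular_module A)"
proof -
  interpret cring A by fact
  have "abelian_group (regular_module A)"
    by (rule abelian_groupI) (auto simp: regular_module_def a_ac intro!: bexI[of _ "\<ominus>\<^bsub>A\<^esub> _"] l_neg)
  then show ?thesis
    by (intro moduleI assms) (auto simp: regular_module_def l_distr r_distr m_assoc)
qed

section \<open>Cosets and quotient modules\<close>

context
  fixes A :: "('a, 'r) ring_scheme" and M :: "('a, 'm) module" and K :: "'m set"
  assumes M: "module A M" and K: "submodule K A M"
begin

interpretation M: module A M by (rule M)

lemma submodule_abelian_subgroup: "abelian_subgroup K M"
  using K by (intro abelian_subgroupI3 additive_subgroup.intro)
    (auto simp: submodule_def M.abelian_group_axioms)

interpretation abelian_subgroup K M by (rule submodule_abelian_subgroup)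

lemma coset_mem_iff:
  assumes "x \<in> carrier M"
  shows "y \<in> K +>\<^bsub>M\<^esub> x \<longleftrightarrow> y \<in> carrier M \<and> y \<ominus>\<^bsub>M\<^esub> x \<in> K"
proof
  assume "y \<in> K +>\<^bsub>M\<^esub> x"
  then obtain h where h: "h \<in> K" "y = h \<oplus>\<^bsub>M\<^esub> x" by (auto simp: a_r_coset_def')
  then have "y \<ominus>\<^bsub>M\<^esub> x = h" using assms a_subset by (auto simp: a_minus_def M.a_assoc M.r_neg)
  with h assms a_subset show "y \<in> carrier M \<and> y \<ominus>\<^bsub>M\<^esub> x \<in> K" by auto
next
  assume y: "y \<in> carrier M \<and> y \<ominus>\<^bsub>M\<^esub> x \<in> K"
  then have "y = (y \<ominus>\<^bsub>M\<^esub> x) \<oplus>\<^bsub>M\<^esub> x" using assms by (auto simp: a_minus_def M.a_assoc M.l_neg)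
  with y show "y \<in> K +>\<^bsub>M\<^esub> x" by (auto simp: a_r_coset_def')
qed

lemma coset_self: "x \<in> carrier M \<Longrightarrow> x \<in> K +>\<^bsub>M\<^esub> x"
  by (simp add: coset_mem_iff M.minus_eq M.r_neg)

lemma coset_eqI:
  assumes "x \<in> carrier M" "y \<in> carrier M" "x \<ominus>\<^bsub>M\<^esub> y \<in> K"
  shows "K +>\<^bsub>M\<^esub> x = K +>\<^bsub>M\<^esub> y"
  using M.a_repr_independence[OF _ assms(2) a_subgroup, of x] assms coset_mem_iff[OF assms(2)] by auto

lemma coset_eq_iff:
  assumes "x \<in> carrier M" "y \<in> carrier M"
  shows "K +>\<^bsub>M\<^esub> x = K +>\<^bsub>M\<^esub> y \<longleftrightarrow> x \<ominus>\<^bsub>M\<^esub> y \<in> K"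
  using coset_eqI[OF assms] coset_self[OF assms(1)] coset_mem_iff[OF assms(2)] by auto

lemma coset_eq_submodule_iff:
  assumes "x \<in> carrier M"
  shows "K +>\<^bsub>M\<^esub> x = K \<longleftrightarrow> x \<in> K"
  using coset_self[OF assms] M.a_coset_join2[OF assms a_subgroup] by auto

lemma coset_zero: "K +>\<^bsub>M\<^esub> \<zero>\<^bsub>M\<^esub> = K"
  by (simp add: coset_eq_submodule_iff)

lemma carrier_quot_module: "carrier (quot_module M K) = (\<lambda>x. K +>\<^bsub>M\<^esub> x) ` carrier M"
  by (auto simp: quot_module_def A_RCOSETS_def')

lemma zero_quot_module: "\<zero>\<^bsub>quot_module M K\<^esub> = K"
  by (simp add: quot_module_def)

lemma coset_in_quot_module: "x \<in> carrier M \<Longrightarrow> K +>\<^bsub>M\<^esub> x \<in> carrier (quot_module M K)"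
  by (simp add: carrier_quot_module)

lemma add_quot_module:
  "x \<in> carrier M \<Longrightarrow> y \<in> carrier M
    \<Longrightarrow> (K +>\<^bsub>M\<^esub> x) \<oplus>\<^bsub>quot_module M K\<^esub> (K +>\<^bsub>M\<^esub> y) = K +>\<^bsub>M\<^esub> (x \<oplus>\<^bsub>M\<^esub> y)"
  by (simp add: quot_module_def a_rcos_sum)

end

lemma quot_map_coset:
  assumes M: "module A M" and K: "submodule K A M" and N: "module A N" and L: "submodule L A N"
    and f: "f \<in> linear_maps A M N" "\<And>x. x \<in> K \<Longrightarrow> f x \<in> L" and x: "x \<in> carrier M"
  shows "quot_map N L f (K +>\<^bsub>M\<^esub> x) = L +>\<^bsub>N\<^esub> f x"
proof -
  have "L +>\<^bsub>N\<^esub> f y = L +>\<^bsub>N\<^esub> f x" if y: "y \<in> K +>\<^bsub>M\<^esub> x" for y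
  proof -
    have y': "y \<in> carrier M" "y \<ominus>\<^bsub>M\<^esub> x \<in> K" using y coset_mem_iff[OF M K x] by auto
    then have "f y \<ominus>\<^bsub>N\<^esub> f x \<in> L"
      using f(2)[of "y \<ominus>\<^bsub>M\<^esub> x"] x by (simp add: linear_maps_diff[OF M N f(1)])
    then show ?thesis
      by (rule coset_eqI[OF N L linear_maps_closed[OF f(1) y'(1)] linear_maps_closed[OF f(1) x]])
  qed
  with coset_self[OF M K x] show ?thesis unfolding quot_map_def by blast
qed

lemma smult_linear:
  assumes "module A M" "a \<in> carrier A"
  shows "(\<lambda>x. a \<odot>\<^bsub>M\<^esub> x) \<in> linear_maps A M M"
proof -
  interpret M: module A M by fact
  show ?thesis using assms(2)
    by (intro linear_mapsI) (simp_all add: M.smult_r_distr,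
        metis M.smult_assoc1 M.R.m_comm)
qed

lemma smult_quot_module:
  assumes "module A M" "submodule K A M" "a \<in> carrier A" "x \<in> carrier M"
  shows "a \<odot>\<^bsub>quot_module M K\<^esub> (K +>\<^bsub>M\<^esub> x) = K +>\<^bsub>M\<^esub> (a \<odot>\<^bsub>M\<^esub> x)"
  using quot_map_coset[OF assms(1,2,1,2) smult_linear[OF assms(1,3)]]
    submodule_smult[OF assms(2,3)] assms(4)
  by (simp add: quot_module_def quot_map_def)

lemma coset_linear:
  assumes "module A M" "submodule K A M"
  shows "(\<lambda>x. K +>\<^bsub>M\<^esub> x) \<in> linear_maps A M (quot_module M K)"
  by (rule linear_mapsI) (simp_all add: coset_in_quot_module[OF assms] add_quot_module[OF assms]
      smult_quot_module[OF assms])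

text \<open>The module axioms are identities, apart from closure and the existence of negatives, and
  all of them pass to an image under a map that respects the operations. The target is not assumed
  to be a module, so quotients of any encoding can be treated this way.\<close>

lemma module_surjective_image:
  assumes M: "module A M" and f: "f \<in> linear_maps A M N"
    and surj: "carrier N = f ` carrier M" and zero: "\<zero>\<^bsub>N\<^esub> = f \<zero>\<^bsub>M\<^esub>"
  shows "module A N"
proof -
  interpret M: module A M by fact
  note fs = linear_maps_add[OF f, symmetric] linear_maps_smult[OF f, symmetric]
  have fE: thesis if "u \<in> carrier N" "\<And>x. x \<in> carrier M \<Longrightarrow> u = f x \<Longrightarrow> thesis" for u thesis
    using that unfolding surj by blast
  have closed: "x \<in> carrier M \<Longrightarrow> f x \<in> carrier N" for x by (simp add: surj)
  have neg: "\<exists>v\<in>carrier N. v \<oplus>\<^bsub>N\<^esub> u = \<zero>\<^bsub>N\<^esub>" if u: "u \<in> carrier N" for u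
  proof -
    from u obtain x where x: "x \<in> carrier M" "u = f x" by (metis fE)
    then have "f (\<ominus>\<^bsub>M\<^esub> x) \<oplus>\<^bsub>N\<^esub> u = \<zero>\<^bsub>N\<^esub>"
      unfolding zero by (simp only: fs M.a_inv_closed M.l_neg)
    with closed[of "\<ominus>\<^bsub>M\<^esub> x"] x show ?thesis by blast
  qed
  have "abelian_group N"
    by (rule abelian_groupI; (erule neg)?; (elim fE)?)
      (simp_all only: zero fs closed M.a_closed M.a_ac M.zero_closed M.l_zero M.r_zero)
  then show ?thesis
    by (rule moduleI[OF M.is_cring]; elim fE)
      (simp_all only: fs closed M.smult_closed M.a_closed M.smult_l_distr
        M.smult_r_distr M.smult_assoc1 M.smult_one M.R.a_closed M.R.m_closed M.R.one_closed)
qed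

lemma quot_module_module:
  assumes "module A M" "submodule K A M"
  shows "module A (quot_module M K)"
  by (rule module_surjective_image[OF assms(1) coset_linear[OF assms]])
    (simp_all add: carrier_quot_module[OF assms] zero_quot_module[OF assms] coset_zero[OF assms])

text \<open>The universal property of a quotient, for an arbitrary surjection \<open>\<rho>\<close>
  instead of the coset map, so that it also applies to the copy of a quotient built in
  \<open>quotient_in_type\<close>.\<close>

lemma linear_factor:
  assumes M: "module A M" and N: "module A N" and T: "module A T"
    and f: "f \<in> linear_maps A M N" and \<rho>: "\<rho> \<in> linear_maps A M T" and surj: "carrier T = \<rho> ` carrier M"
    and ker: "\<And>x. x \<in> carrier M \<Longrightarrow> \<rho> x = \<zero>\<^bsub>T\<^esub> \<Longrightarrow> f x = \<zero>\<^bsub>N\<^esub>"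
  obtains f' where "f' \<in> linear_maps A T N" "\<And>x. x \<in> carrier M \<Longrightarrow> f' (\<rho> x) = f x"
proof
  interpret M: module A M by fact
  interpret N: module A N by fact
  interpret T: module A T by fact
  \<comment> \<open>Any choice of preimages gives the same map: two preimages of an element differ
    by an element of the kernel of \<open>\<rho>\<close>, which \<open>f\<close> kills by
    \<open>ker\<close>.\<close>
  let ?f = "\<lambda>t. f (inv_into (carrier M) \<rho> t)"
  show eq: "?f (\<rho> x) = f x" if x: "x \<in> carrier M" for x
  proof -
    let ?y = "inv_into (carrier M) \<rho> (\<rho> x)"
    have y: "?y \<in> carrier M" "\<rho> ?y = \<rho> x" using x by (auto intro: inv_into_into f_inv_into_f)
    then have "\<rho> (?y \<ominus>\<^bsub>M\<^esub> x) = \<zero>\<^bsub>T\<^esub>"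
      using x linear_maps_closed[OF \<rho> x] by (simp add: linear_maps_diff[OF M T \<rho>] T.minus_eq T.r_neg)
    then have "f ?y \<ominus>\<^bsub>N\<^esub> f x = \<zero>\<^bsub>N\<^esub>"
      using ker[of "?y \<ominus>\<^bsub>M\<^esub> x"] x y by (simp add: linear_maps_diff[OF M N f])
    then show ?thesis
      using linear_maps_closed[OF f] x y(1) by (metis N.minus_eq N.add.inv_closed N.minus_equality N.minus_minus)
  qed
  show "?f \<in> linear_maps A T N"
  proof (rule linear_mapsI)
    fix t assume "t \<in> carrier T"
    then obtain x where x: "x \<in> carrier M" "t = \<rho> x" by (auto simp: surj)
    then show "?f t \<in> carrier N" by (simp only: eq linear_maps_closed[OF f])
    show "?f (a \<odot>\<^bsub>T\<^esub> t) = a \<odot>\<^bsub>N\<^esub> ?f t" if "a \<in> carrier A" for a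
      using x that
      by (simp only: eq linear_maps_smult[OF f] linear_maps_smult[OF \<rho>, symmetric] M.smult_closed)
    fix u assume "u \<in> carrier T"
    then obtain y where y: "y \<in> carrier M" "u = \<rho> y" by (auto simp: surj)
    with x show "?f (t \<oplus>\<^bsub>T\<^esub> u) = ?f t \<oplus>\<^bsub>N\<^esub> ?f u"
      by (simp only: eq linear_maps_add[OF f] linear_maps_add[OF \<rho>, symmetric] M.a_closed)
  qed
qed

text \<open>The quotient is realised on coset representatives, so that it has the type of \<open>M\<close>.\<close>

lemma quotient_in_type:
  fixes M :: "('a, 'm) module"
  assumes M: "module A M" and K: "submodule K A M"
  obtains T :: "('a, 'm) module" and \<rho> where "module A T" "\<rho> \<in> linear_maps A M T"
    "carrier T = \<rho> ` carrier M" "\<And>x. x \<in> carrier M \<Longrightarrow> \<rho> x = \<zero>\<^bsub>T\<^esub> \<longleftrightarrow> x \<in> K"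
proof
  interpret M: module A M by fact
  interpret Q: module A "quot_module M K" by (rule quot_module_module[OF M K])
  \<comment> \<open>The choice depends on the coset alone, so \<open>\<rho>\<close> takes one value
    on each coset and that value represents it.\<close>
  define \<rho> where "\<rho> x = (SOME y. y \<in> K +>\<^bsub>M\<^esub> x)" for x
  let ?T = "mk_module (\<rho> ` carrier M) (\<rho> \<zero>\<^bsub>M\<^esub>) (\<lambda>x y. \<rho> (x \<oplus>\<^bsub>M\<^esub> y)) (\<lambda>a x. \<rho> (a \<odot>\<^bsub>M\<^esub> x)) :: ('a, 'm) module"
  have \<rho>: "\<rho> x \<in> carrier M" "K +>\<^bsub>M\<^esub> \<rho> x = K +>\<^bsub>M\<^esub> x" if x: "x \<in> carrier M" for x
  proof -
    have *: "\<rho> x \<in> K +>\<^bsub>M\<^esub> x" unfolding \<rho>_def using coset_self[OF M K x] by (rule someI)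
    then show "\<rho> x \<in> carrier M" using coset_mem_iff[OF M K x] by simp
    with * show "K +>\<^bsub>M\<^esub> \<rho> x = K +>\<^bsub>M\<^esub> x"
      using coset_mem_iff[OF M K x] coset_eqI[OF M K _ x] by blast
  qed
  have eq: "\<rho> x = \<rho> y" if "K +>\<^bsub>M\<^esub> x = K +>\<^bsub>M\<^esub> y" for x y using that by (simp add: \<rho>_def)
  have eq_iff: "\<rho> x = \<rho> y \<longleftrightarrow> K +>\<^bsub>M\<^esub> x = K +>\<^bsub>M\<^esub> y" if "x \<in> carrier M" "y \<in> carrier M" for x y
    using that \<rho>(2) eq by metis
  show lin: "\<rho> \<in> linear_maps A M ?T"
  proof (rule linear_mapsI)
    fix x assume x: "x \<in> carrier M"
    show "\<rho> (a \<odot>\<^bsub>M\<^esub> x) = a \<odot>\<^bsub>?T\<^esub> \<rho> x" if "a \<in> carrier A" for a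
      using that x \<rho>[OF x] smult_quot_module[OF M K that]
      by (auto intro!: eq) metis+
    show "\<rho> (x \<oplus>\<^bsub>M\<^esub> y) = \<rho> x \<oplus>\<^bsub>?T\<^esub> \<rho> y" if "y \<in> carrier M" for y
      using that x \<rho>[OF x] \<rho>[OF that] add_quot_module[OF M K]
      by (auto intro!: eq) metis+
  qed simp
  show "module A ?T" by (rule module_surjective_image[OF M lin]) simp_all
  show "\<rho> x = \<zero>\<^bsub>?T\<^esub> \<longleftrightarrow> x \<in> K" if "x \<in> carrier M" for x
    using that coset_eq_submodule_iff[OF M K that] by (simp add: eq_iff coset_zero[OF M K])
qed simp

lemma quot_map_linear:
  assumes M: "module A M" and K: "submodule K A M" and N: "module A N" and L: "submodule L A N"
    and f: "f \<in> linear_maps A M N" "\<And>x. x \<in> K \<Longrightarrow> f x \<in> L"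
  shows "quot_map N L f \<in> linear_maps A (quot_module M K) (quot_module N L)"
proof -
  interpret M: module A M by fact
  note map = quot_map_coset[OF M K N L f]
  note Mrules = carrier_quot_module[OF M K] add_quot_module[OF M K] smult_quot_module[OF M K]
  note Nrules = coset_in_quot_module[OF N L] add_quot_module[OF N L] smult_quot_module[OF N L]
  note fs = linear_maps_closed[OF f(1)] linear_maps_add[OF f(1)] linear_maps_smult[OF f(1)]
  show ?thesis
  proof (rule linear_mapsI)
    fix X assume "X \<in> carrier (quot_module M K)"
    then obtain x where x: "x \<in> carrier M" "X = K +>\<^bsub>M\<^esub> x" unfolding Mrules by blast
    then show "quot_map N L f X \<in> carrier (quot_module N L)" by (simp add: map Nrules fs)
    fix a assume "a \<in> carrier A"
    with x show "quot_map N L f (a \<odot>\<^bsub>quot_module M K\<^esub> X) = a \<odot>\<^bsub>quot_module N L\<^esub> quot_map N L f X"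
      by (simp add: map Nrules Mrules fs)
  next
    fix X Y assume "X \<in> carrier (quot_module M K)" "Y \<in> carrier (quot_module M K)"
    then obtain x y where "x \<in> carrier M" "X = K +>\<^bsub>M\<^esub> x" "y \<in> carrier M" "Y = K +>\<^bsub>M\<^esub> y"
      unfolding Mrules by blast
    then show "quot_map N L f (X \<oplus>\<^bsub>quot_module M K\<^esub> Y)
        = quot_map N L f X \<oplus>\<^bsub>quot_module N L\<^esub> quot_map N L f Y"
      by (simp add: map Nrules Mrules fs)
  qed
qed

section \<open>Free modules and tensor products\<close>

lemma free_module_module:
  assumes "cring A" shows "module A (free_module A S)"
proof -
  interpret cring A by fact
  have fin: "finite {x. \<phi> x \<noteq> \<zero>\<^bsub>A\<^esub>} \<Longrightarrow> finite {x. \<psi> x \<noteq> \<zero>\<^bsub>A\<^esub>}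
      \<Longrightarrow> finite {x. \<phi> x \<oplus>\<^bsub>A\<^esub> \<psi> x \<noteq> \<zero>\<^bsub>A\<^esub>}" for \<phi> \<psi> :: "'c \<Rightarrow> 'a"
    by (rule finite_subset[of _ "{x. \<phi> x \<noteq> \<zero>\<^bsub>A\<^esub>} \<union> {x. \<psi> x \<noteq> \<zero>\<^bsub>A\<^esub>}"]) auto
  have fin': "finite {x. \<phi> x \<noteq> \<zero>\<^bsub>A\<^esub>} \<Longrightarrow> a \<in> carrier A \<Longrightarrow> finite {x. a \<otimes>\<^bsub>A\<^esub> \<phi> x \<noteq> \<zero>\<^bsub>A\<^esub>}"
    for \<phi> :: "'c \<Rightarrow> 'a" and a
    by (rule finite_subset[of _ "{x. \<phi> x \<noteq> \<zero>\<^bsub>A\<^esub>}"]) auto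
  have neg: "\<exists>\<psi>\<in>carrier (free_module A S). \<psi> \<oplus>\<^bsub>free_module A S\<^esub> \<phi> = \<zero>\<^bsub>free_module A S\<^esub>"
    if \<phi>: "\<phi> \<in> carrier (free_module A S)" for \<phi> :: "'c \<Rightarrow> 'a"
  proof (rule bexI)
    show "(\<lambda>x. \<ominus>\<^bsub>A\<^esub> \<phi> x) \<oplus>\<^bsub>free_module A S\<^esub> \<phi> = \<zero>\<^bsub>free_module A S\<^esub>"
      using \<phi> by (auto simp: free_module_def l_neg)
    have "{x. \<ominus>\<^bsub>A\<^esub> \<phi> x \<noteq> \<zero>\<^bsub>A\<^esub>} \<subseteq> {x. \<phi> x \<noteq> \<zero>\<^bsub>A\<^esub>}" by auto
    with \<phi> show "(\<lambda>x. \<ominus>\<^bsub>A\<^esub> \<phi> x) \<in> carrier (free_module A S)"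
      by (auto simp: free_module_def intro: finite_subset)
  qed
  have "abelian_group (free_module A S)"
    by (rule abelian_groupI; (erule neg)?) (auto simp: free_module_def a_ac fin)
  then show ?thesis
    by (rule moduleI[OF assms]) (auto simp: free_module_def l_distr r_distr m_assoc fin')
qed

lemma free_basis_closed:
  "cring A \<Longrightarrow> s \<in> S \<Longrightarrow> free_basis A s \<in> carrier (free_module A S)"
  by (auto simp: free_module_def free_basis_def cring.cring_simprules
      intro!: finite_subset[of "{y. (if y = s then \<one>\<^bsub>A\<^esub> else \<zero>\<^bsub>A\<^esub>) \<noteq> \<zero>\<^bsub>A\<^esub>}" "{s}"] split: if_splits)

text \<open>This is the induction principle for free modules: a property that cuts out a submodule
  need only be tested on the basis. The proof is by induction on a finite set containing the
  support; clearing one coordinate splits off a multiple of a basis element.\<close>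

lemma free_module_subset:
  assumes A: "cring A" and N: "submodule N A (free_module A S)"
    and basis: "\<And>s. s \<in> S \<Longrightarrow> free_basis A s \<in> N"
  shows "carrier (free_module A S) \<subseteq> N"
proof
  interpret cring A by fact
  have *: "\<phi> \<in> N" if "finite D" "\<phi> \<in> carrier (free_module A S)" "{x. \<phi> x \<noteq> \<zero>\<^bsub>A\<^esub>} \<subseteq> D" for D \<phi>
    using that
  proof (induction D arbitrary: \<phi>)
    case empty
    then have "\<phi> = \<zero>\<^bsub>free_module A S\<^esub>" by (auto simp: free_module_def)
    then show ?case using submodule_zero[OF N] by simp
  next
    case (insert d D)
    show ?case
    proof (cases "d \<in> S")
      case True
      let ?\<psi> = "\<phi>(d := \<zero>\<^bsub>A\<^esub>)"
      have "finite {x. ?\<psi> x \<noteq> \<zero>\<^bsub>A\<^esub>}"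
        by (rule finite_subset[of _ "{x. \<phi> x \<noteq> \<zero>\<^bsub>A\<^esub>}"])
          (use insert.prems in \<open>auto simp: free_module_def\<close>)
      then have "?\<psi> \<in> carrier (free_module A S)"
        using insert.prems by (auto simp: free_module_def)
      moreover have "{x. ?\<psi> x \<noteq> \<zero>\<^bsub>A\<^esub>} \<subseteq> D" using insert.prems by auto
      ultimately have "?\<psi> \<in> N" by (rule insert.IH)
      moreover have "\<phi> = ?\<psi> \<oplus>\<^bsub>free_module A S\<^esub> \<phi> d \<odot>\<^bsub>free_module A S\<^esub> free_basis A d"
        using insert.prems by (auto simp: free_module_def free_basis_def fun_eq_iff)
      moreover have "\<phi> d \<in> carrier A" using insert.prems by (auto simp: free_module_def)
      ultimately show ?thesis
        using submodule_add[OF N] submodule_smult[OF N] basis[OF True] by metis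
    next
      case False
      then have "\<phi> d = \<zero>\<^bsub>A\<^esub>" using insert.prems by (auto simp: free_module_def)
      then have "{x. \<phi> x \<noteq> \<zero>\<^bsub>A\<^esub>} \<subseteq> D" using insert.prems by auto
      with insert.prems(1) show ?thesis by (rule insert.IH)
    qed
  qed
  fix \<phi> assume "\<phi> \<in> carrier (free_module A S)"
  moreover from this have "finite {x. \<phi> x \<noteq> \<zero>\<^bsub>A\<^esub>}" by (simp add: free_module_def)
  ultimately show "\<phi> \<in> N" using * by blast
qed

section \<open>Linear maps out of free modules\<close>

definition free_lift ::
  "('a, 'r) ring_scheme \<Rightarrow> ('a, 'm) module \<Rightarrow> ('s \<Rightarrow> 'm) \<Rightarrow> ('s \<Rightarrow> 'a) \<Rightarrow> 'm" where
  "free_lift A M \<beta> \<phi> = (\<Oplus>\<^bsub>M\<^esub>s\<in>{s. \<phi> s \<noteq> \<zero>\<^bsub>A\<^esub>}. \<phi> s \<odot>\<^bsub>M\<^esub> \<beta> s)"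

text \<open>The range of summation in \<open>free_lift\<close> varies with \<open>\<phi>\<close>.
  Padding with zero terms up to a common finite set makes additivity a statement about single
  terms.\<close>

lemma free_lift_eq:
  assumes "module A M" "\<beta> \<in> S \<rightarrow> carrier M" "\<phi> \<in> carrier (free_module A S)"
    and "finite D" "{s. \<phi> s \<noteq> \<zero>\<^bsub>A\<^esub>} \<subseteq> D" "D \<subseteq> S"
  shows "free_lift A M \<beta> \<phi> = (\<Oplus>\<^bsub>M\<^esub>s\<in>D. \<phi> s \<odot>\<^bsub>M\<^esub> \<beta> s)"
proof -
  interpret M: module A M by fact
  have "\<beta> s \<in> carrier M" if "s \<in> D" for s using assms(2,6) that by auto
  then show ?thesis unfolding free_lift_def
    using assms
    by (intro M.add.finprod_mono_neutral_cong_left) (auto simp: free_module_def)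
qed

lemma free_lift_linear:
  assumes M: "module A M" and \<beta>: "\<beta> \<in> S \<rightarrow> carrier M"
  shows "free_lift A M \<beta> \<in> linear_maps A (free_module A S) M"
proof -
  interpret M: module A M by fact
  let ?F = "free_module A S"
  interpret F: module A ?F by (rule free_module_module[OF M.is_cring])
  have supp: "finite {s. \<phi> s \<noteq> \<zero>\<^bsub>A\<^esub>}" "{s. \<phi> s \<noteq> \<zero>\<^bsub>A\<^esub>} \<subseteq> S" "\<And>s. \<phi> s \<in> carrier A"
    if "\<phi> \<in> carrier ?F" for \<phi> using that by (auto simp: free_module_def)
  note eq = free_lift_eq[OF M \<beta>]
  show ?thesis
  proof (rule linear_mapsI)
    fix \<phi> assume \<phi>: "\<phi> \<in> carrier ?F"
    show "free_lift A M \<beta> \<phi> \<in> carrier M" unfolding free_lift_def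
      using supp[OF \<phi>] \<beta> by (intro M.finsum_closed) auto
    fix a assume a: "a \<in> carrier A"
    let ?D = "{s. \<phi> s \<noteq> \<zero>\<^bsub>A\<^esub>}"
    have \<beta>D: "\<beta> s \<in> carrier M" if "\<phi> s \<noteq> \<zero>\<^bsub>A\<^esub>" for s using that supp[OF \<phi>] \<beta> by auto
    have "(a \<odot>\<^bsub>?F\<^esub> \<phi>) = (\<lambda>s. a \<otimes>\<^bsub>A\<^esub> \<phi> s)" by (simp add: free_module_def)
    moreover from this F.smult_closed[OF a \<phi>] have "(\<lambda>s. a \<otimes>\<^bsub>A\<^esub> \<phi> s) \<in> carrier ?F" by simp
    ultimately have "free_lift A M \<beta> (a \<odot>\<^bsub>?F\<^esub> \<phi>) = (\<Oplus>\<^bsub>M\<^esub>s\<in>?D. (a \<otimes>\<^bsub>A\<^esub> \<phi> s) \<odot>\<^bsub>M\<^esub> \<beta> s)"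
      using supp[OF \<phi>] a \<phi> by (subst eq[of _ ?D]) auto
    also have "\<dots> = (\<Oplus>\<^bsub>M\<^esub>s\<in>?D. a \<odot>\<^bsub>M\<^esub> (\<phi> s \<odot>\<^bsub>M\<^esub> \<beta> s))"
      using supp[OF \<phi>] a \<beta>D by (intro M.finsum_cong') (auto intro!: M.smult_assoc1)
    also have "\<dots> = a \<odot>\<^bsub>M\<^esub> free_lift A M \<beta> \<phi>" unfolding free_lift_def
      using supp[OF \<phi>] a \<beta>D by (intro M.finsum_smult_ldistr[symmetric]) auto
    finally show "free_lift A M \<beta> (a \<odot>\<^bsub>?F\<^esub> \<phi>) = a \<odot>\<^bsub>M\<^esub> free_lift A M \<beta> \<phi>" .
  next
    fix \<phi> \<psi> assume \<phi>: "\<phi> \<in> carrier ?F" and \<psi>: "\<psi> \<in> carrier ?F"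
    let ?D = "{s. \<phi> s \<noteq> \<zero>\<^bsub>A\<^esub>} \<union> {s. \<psi> s \<noteq> \<zero>\<^bsub>A\<^esub>}"
    have D: "finite ?D" "?D \<subseteq> S" using supp[OF \<phi>] supp[OF \<psi>] by auto
    then have \<beta>D: "\<beta> s \<in> carrier M" if "s \<in> ?D" for s using that \<beta> by auto
    have "(\<phi> \<oplus>\<^bsub>?F\<^esub> \<psi>) = (\<lambda>s. \<phi> s \<oplus>\<^bsub>A\<^esub> \<psi> s)" by (simp add: free_module_def)
    moreover have "\<phi> \<oplus>\<^bsub>?F\<^esub> \<psi> \<in> carrier ?F" using \<phi> \<psi> by (rule F.a_closed)
    moreover from calculation(1) have "{s. (\<phi> \<oplus>\<^bsub>?F\<^esub> \<psi>) s \<noteq> \<zero>\<^bsub>A\<^esub>} \<subseteq> ?D" by auto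
    ultimately have "free_lift A M \<beta> (\<phi> \<oplus>\<^bsub>?F\<^esub> \<psi>) = (\<Oplus>\<^bsub>M\<^esub>s\<in>?D. (\<phi> s \<oplus>\<^bsub>A\<^esub> \<psi> s) \<odot>\<^bsub>M\<^esub> \<beta> s)"
      using D by (subst eq[of _ ?D]) auto
    also have "\<dots> = (\<Oplus>\<^bsub>M\<^esub>s\<in>?D. \<phi> s \<odot>\<^bsub>M\<^esub> \<beta> s \<oplus>\<^bsub>M\<^esub> \<psi> s \<odot>\<^bsub>M\<^esub> \<beta> s)"
      using supp[OF \<phi>] supp[OF \<psi>] \<beta>D by (intro M.finsum_cong') (auto intro!: M.smult_l_distr)
    also have "\<dots> = (\<Oplus>\<^bsub>M\<^esub>s\<in>?D. \<phi> s \<odot>\<^bsub>M\<^esub> \<beta> s) \<oplus>\<^bsub>M\<^esub> (\<Oplus>\<^bsub>M\<^esub>s\<in>?D. \<psi> s \<odot>\<^bsub>M\<^esub> \<beta> s)"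
      using supp[OF \<phi>] supp[OF \<psi>] \<beta>D by (intro M.finsum_addf) auto
    also have "\<dots> = free_lift A M \<beta> \<phi> \<oplus>\<^bsub>M\<^esub> free_lift A M \<beta> \<psi>"
      using eq[OF \<phi> D(1) _ D(2)] eq[OF \<psi> D(1) _ D(2)] by simp
    finally show "free_lift A M \<beta> (\<phi> \<oplus>\<^bsub>?F\<^esub> \<psi>) = free_lift A M \<beta> \<phi> \<oplus>\<^bsub>M\<^esub> free_lift A M \<beta> \<psi>" .
  qed
qed

lemma free_lift_basis:
  assumes M: "module A M" and "\<beta> \<in> S \<rightarrow> carrier M" and s: "s \<in> S"
  shows "free_lift A M \<beta> (free_basis A s) = \<beta> s"
proof -
  interpret M: module A M by fact
  have \<beta>s: "\<beta> s \<in> carrier M" using assms by auto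
  have "free_lift A M \<beta> (free_basis A s) = (\<Oplus>\<^bsub>M\<^esub>t\<in>{s}. free_basis A s t \<odot>\<^bsub>M\<^esub> \<beta> t)"
    using free_basis_closed[OF M.is_cring s] assms
    by (intro free_lift_eq) (auto simp: free_basis_def)
  also have "\<dots> = \<beta> s" using \<beta>s by (simp add: free_basis_def)
  finally show ?thesis .
qed

text \<open>Each coordinate of \<open>free_map\<close> is the linear functional that extends the
  indicator function of the fibre of \<open>h\<close> over \<open>y\<close>. Linearity of
  \<open>free_map\<close> and its values on the basis then follow from the facts about
  \<open>free_lift\<close>.\<close>

lemma free_map_eq_free_lift:
  assumes A: "cring A" and \<phi>: "\<phi> \<in> carrier (free_module A S)"
  shows "free_map A h \<phi> y =
    free_lift A (regular_module A) (\<lambda>x. if h x = y then \<one>\<^bsub>A\<^esub> else \<zero>\<^bsub>A\<^esub>) \<phi>"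
proof -
  interpret cring A by fact
  have "free_lift A (regular_module A) (\<lambda>x. if h x = y then \<one>\<^bsub>A\<^esub> else \<zero>\<^bsub>A\<^esub>) \<phi>
    = (\<Oplus>\<^bsub>A\<^esub>x\<in>{x. \<phi> x \<noteq> \<zero>\<^bsub>A\<^esub>}. \<phi> x \<otimes>\<^bsub>A\<^esub> (if h x = y then \<one>\<^bsub>A\<^esub> else \<zero>\<^bsub>A\<^esub>))"
    \<comment> \<open>Sums in \<open>regular_module A\<close> and in \<open>A\<close> agree because
      a finite sum depends only on the carrier, the zero and the addition, which the two
      share.\<close>
    by (simp add: free_lift_def finsum_def regular_module_def finprod_def)
  also have "\<dots> = free_map A h \<phi> y" unfolding free_map_def
    using \<phi> by (intro add.finprod_mono_neutral_cong_right) (auto simp: free_module_def)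
  finally show ?thesis by simp
qed

lemma free_map_linear:
  assumes A: "cring A" and h: "h \<in> S \<rightarrow> T"
  shows "free_map A h \<in> linear_maps A (free_module A S) (free_module A T)"
proof -
  interpret cring A by fact
  let ?F = "free_module A S"
  interpret F: module A ?F by (rule free_module_module[OF A])
  let ?l = "\<lambda>y. free_lift A (regular_module A) (\<lambda>x. if h x = y then \<one>\<^bsub>A\<^esub> else \<zero>\<^bsub>A\<^esub>)"
  have lin: "?l y \<in> linear_maps A ?F (regular_module A)" for y
    by (rule free_lift_linear[OF regular_module_module[OF A]]) (auto simp: regular_module_def)
  note eq = free_map_eq_free_lift[OF A, of _ S]
  have sm: "(\<oplus>\<^bsub>regular_module A\<^esub>) = (\<oplus>\<^bsub>A\<^esub>)" "smult (regular_module A) = (\<otimes>\<^bsub>A\<^esub>)"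
    "carrier (regular_module A) = carrier A" by (simp_all add: regular_module_def)
  show ?thesis
  proof (rule linear_mapsI)
    fix \<phi> assume \<phi>: "\<phi> \<in> carrier ?F"
    have "free_map A h \<phi> y \<in> carrier A" for y
      using linear_maps_closed[OF lin \<phi>, of y] by (simp add: eq[OF \<phi>] sm)
    moreover have "\<exists>x. \<phi> x \<noteq> \<zero>\<^bsub>A\<^esub> \<and> h x = y" if "free_map A h \<phi> y \<noteq> \<zero>\<^bsub>A\<^esub>" for y
    proof (rule ccontr)
      assume "\<nexists>x. \<phi> x \<noteq> \<zero>\<^bsub>A\<^esub> \<and> h x = y"
      then have "{x. \<phi> x \<noteq> \<zero>\<^bsub>A\<^esub> \<and> h x = y} = {}" by blast
      with that show False by (simp add: free_map_def)
    qed
    then have *: "{y. free_map A h \<phi> y \<noteq> \<zero>\<^bsub>A\<^esub>} \<subseteq> h ` {x. \<phi> x \<noteq> \<zero>\<^bsub>A\<^esub>}" by blast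
    moreover have fin: "finite {x. \<phi> x \<noteq> \<zero>\<^bsub>A\<^esub>}" and "{x. \<phi> x \<noteq> \<zero>\<^bsub>A\<^esub>} \<subseteq> S"
      using \<phi> by (auto simp: free_module_def)
    moreover from * finite_imageI[OF fin] have "finite {y. free_map A h \<phi> y \<noteq> \<zero>\<^bsub>A\<^esub>}"
      by (rule finite_subset)
    ultimately show "free_map A h \<phi> \<in> carrier (free_module A T)"
      using h by (fastforce simp: free_module_def)
    fix a assume a: "a \<in> carrier A"
    show "free_map A h (a \<odot>\<^bsub>?F\<^esub> \<phi>) = a \<odot>\<^bsub>free_module A T\<^esub> free_map A h \<phi>"
    proof
      fix y
      have "free_map A h (a \<odot>\<^bsub>?F\<^esub> \<phi>) y = a \<otimes>\<^bsub>A\<^esub> free_map A h \<phi> y"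
        using linear_maps_smult[OF lin a \<phi>] a \<phi> by (simp add: eq sm)
      then show "free_map A h (a \<odot>\<^bsub>?F\<^esub> \<phi>) y = (a \<odot>\<^bsub>free_module A T\<^esub> free_map A h \<phi>) y"
        by (simp add: free_module_def[of _ T])
    qed
  next
    fix \<phi> \<psi> assume \<phi>: "\<phi> \<in> carrier ?F" and \<psi>: "\<psi> \<in> carrier ?F"
    show "free_map A h (\<phi> \<oplus>\<^bsub>?F\<^esub> \<psi>) = free_map A h \<phi> \<oplus>\<^bsub>free_module A T\<^esub> free_map A h \<psi>"
    proof
      fix y
      have "free_map A h (\<phi> \<oplus>\<^bsub>?F\<^esub> \<psi>) y = free_map A h \<phi> y \<oplus>\<^bsub>A\<^esub> free_map A h \<psi> y"
        using linear_maps_add[OF lin \<phi> \<psi>] \<phi> \<psi> by (simp add: eq sm)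
      then show "free_map A h (\<phi> \<oplus>\<^bsub>?F\<^esub> \<psi>) y = (free_map A h \<phi> \<oplus>\<^bsub>free_module A T\<^esub> free_map A h \<psi>) y"
        by (simp add: free_module_def[of _ T])
    qed
  qed
qed

lemma free_map_basis:
  assumes A: "cring A"
  shows "free_map A h (free_basis A s) = free_basis A (h s)"
proof
  interpret cring A by fact
  fix y
  let ?\<beta> = "\<lambda>x. if h x = y then \<one>\<^bsub>A\<^esub> else \<zero>\<^bsub>A\<^esub>"
  have "free_map A h (free_basis A s) y = free_lift A (regular_module A) ?\<beta> (free_basis A s)"
    by (rule free_map_eq_free_lift[OF A free_basis_closed[OF A UNIV_I]])
  also have "\<dots> = ?\<beta> s"
    by (rule free_lift_basis[OF regular_module_module[OF A] _ UNIV_I]) (simp add: regular_module_def)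
  finally show "free_map A h (free_basis A s) y = free_basis A (h s) y"
    by (auto simp: free_basis_def)
qed

section \<open>Tensor products as quotients of free modules\<close>

lemma tensor_relations_eq:
  "tensor_relations A M N = submodule_span A (tensor_free A M N)
     ({free_basis A (x \<oplus>\<^bsub>M\<^esub> x', y) \<ominus>\<^bsub>tensor_free A M N\<^esub>
         (free_basis A (x, y) \<oplus>\<^bsub>tensor_free A M N\<^esub> free_basis A (x', y)) | x x' y.
         x \<in> carrier M \<and> x' \<in> carrier M \<and> y \<in> carrier N} \<union>
      {free_basis A (x, y \<oplus>\<^bsub>N\<^esub> y') \<ominus>\<^bsub>tensor_free A M N\<^esub>
         (free_basis A (x, y) \<oplus>\<^bsub>tensor_free A M N\<^esub> free_basis A (x, y')) | x y y'.
         x \<in> carrier M \<and> y \<in> carrier N \<and> y' \<in> carrier N} \<union>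
      {free_basis A (a \<odot>\<^bsub>M\<^esub> x, y) \<ominus>\<^bsub>tensor_free A M N\<^esub>
         (a \<odot>\<^bsub>tensor_free A M N\<^esub> free_basis A (x, y)) | a x y.
         a \<in> carrier A \<and> x \<in> carrier M \<and> y \<in> carrier N} \<union>
      {free_basis A (x, a \<odot>\<^bsub>N\<^esub> y) \<ominus>\<^bsub>tensor_free A M N\<^esub>
         (a \<odot>\<^bsub>tensor_free A M N\<^esub> free_basis A (x, y)) | a x y.
         a \<in> carrier A \<and> x \<in> carrier M \<and> y \<in> carrier N})"
  by (simp add: tensor_relations_def Let_def)

lemma tensor_free_module: "cring A \<Longrightarrow> module A (tensor_free A M N)"
  by (simp add: tensor_free_def free_module_module)

lemma tensor_basis_closed:
  "cring A \<Longrightarrow> x \<in> carrier M \<Longrightarrow> y \<in> carrier N \<Longrightarrow> free_basis A (x, y) \<in> carrier (tensor_free A M N)"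
  by (simp add: tensor_free_def free_basis_closed)

lemma tensor_relations_submodule:
  assumes M: "module A M" and N: "module A N"
  shows "submodule (tensor_relations A M N) A (tensor_free A M N)"
proof -
  interpret M: module A M by fact
  interpret N: module A N by fact
  note F = tensor_free_module[OF M.is_cring, of M N]
  interpret F: module A "tensor_free A M N" by (rule F)
  note basis = tensor_basis_closed[OF M.is_cring, of _ M _ N]
  show ?thesis unfolding tensor_relations_eq
    by (rule submodule_span_submodule[OF F]) (auto intro!: basis F.minus_closed)
qed

lemma tensor_relationsI:
  "\<lbrakk>x \<in> carrier M; x' \<in> carrier M; y \<in> carrier N\<rbrakk> \<Longrightarrow>
     free_basis A (x \<oplus>\<^bsub>M\<^esub> x', y) \<ominus>\<^bsub>tensor_free A M N\<^esub>
       (free_basis A (x, y) \<oplus>\<^bsub>tensor_free A M N\<^esub> free_basis A (x', y)) \<in> tensor_relations A M N"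
  "\<lbrakk>x \<in> carrier M; y \<in> carrier N; y' \<in> carrier N\<rbrakk> \<Longrightarrow>
     free_basis A (x, y \<oplus>\<^bsub>N\<^esub> y') \<ominus>\<^bsub>tensor_free A M N\<^esub>
       (free_basis A (x, y) \<oplus>\<^bsub>tensor_free A M N\<^esub> free_basis A (x, y')) \<in> tensor_relations A M N"
  "\<lbrakk>a \<in> carrier A; x \<in> carrier M; y \<in> carrier N\<rbrakk> \<Longrightarrow>
     free_basis A (a \<odot>\<^bsub>M\<^esub> x, y) \<ominus>\<^bsub>tensor_free A M N\<^esub>
       (a \<odot>\<^bsub>tensor_free A M N\<^esub> free_basis A (x, y)) \<in> tensor_relations A M N"
  "\<lbrakk>a \<in> carrier A; x \<in> carrier M; y \<in> carrier N\<rbrakk> \<Longrightarrow>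
     free_basis A (x, a \<odot>\<^bsub>N\<^esub> y) \<ominus>\<^bsub>tensor_free A M N\<^esub>
       (a \<odot>\<^bsub>tensor_free A M N\<^esub> free_basis A (x, y)) \<in> tensor_relations A M N"
  unfolding tensor_relations_eq by (rule submodule_span_superset; blast)+

lemma tensor_relations_least:
  assumes K: "submodule K A (tensor_free A M N)"
    and "\<And>x x' y. \<lbrakk>x \<in> carrier M; x' \<in> carrier M; y \<in> carrier N\<rbrakk> \<Longrightarrow>
     free_basis A (x \<oplus>\<^bsub>M\<^esub> x', y) \<ominus>\<^bsub>tensor_free A M N\<^esub>
       (free_basis A (x, y) \<oplus>\<^bsub>tensor_free A M N\<^esub> free_basis A (x', y)) \<in> K"
    and "\<And>x y y'. \<lbrakk>x \<in> carrier M; y \<in> carrier N; y' \<in> carrier N\<rbrakk> \<Longrightarrow>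
     free_basis A (x, y \<oplus>\<^bsub>N\<^esub> y') \<ominus>\<^bsub>tensor_free A M N\<^esub>
       (free_basis A (x, y) \<oplus>\<^bsub>tensor_free A M N\<^esub> free_basis A (x, y')) \<in> K"
    and "\<And>a x y. \<lbrakk>a \<in> carrier A; x \<in> carrier M; y \<in> carrier N\<rbrakk> \<Longrightarrow>
     free_basis A (a \<odot>\<^bsub>M\<^esub> x, y) \<ominus>\<^bsub>tensor_free A M N\<^esub>
       (a \<odot>\<^bsub>tensor_free A M N\<^esub> free_basis A (x, y)) \<in> K"
    and "\<And>a x y. \<lbrakk>a \<in> carrier A; x \<in> carrier M; y \<in> carrier N\<rbrakk> \<Longrightarrow>
     free_basis A (x, a \<odot>\<^bsub>N\<^esub> y) \<ominus>\<^bsub>tensor_free A M N\<^esub>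
       (a \<odot>\<^bsub>tensor_free A M N\<^esub> free_basis A (x, y)) \<in> K"
  shows "tensor_relations A M N \<subseteq> K"
  unfolding tensor_relations_eq by (rule submodule_span_least[OF K]) (use assms(2-) in blast)

lemma tensor_module_module:
  assumes "module A M" "module A N"
  shows "module A (tensor_module A M N)"
  unfolding tensor_module_def
  using assms by (intro quot_module_module tensor_free_module tensor_relations_submodule)
    (auto simp: module_def)

lemma tensor_free_map_linear:
  assumes "cring A" "g \<in> linear_maps A M N"
  shows "free_map A (\<lambda>(t, x). (t, g x)) \<in> linear_maps A (tensor_free A T M) (tensor_free A T N)"
  unfolding tensor_free_def
  by (rule free_map_linear[OF assms(1)]) (auto simp: linear_maps_closed[OF assms(2)])

text \<open>On basis elements the map is (t, x) \<mapsto> (t, g x), and linearity of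
  \<open>g\<close> turns each of the four kinds of generating relation into a relation of the same
  kind.\<close>

lemma tensor_free_map_relations:
  assumes T: "module A T" and M: "module A M" and N: "module A N" and g: "g \<in> linear_maps A M N"
    and "\<phi> \<in> tensor_relations A T M"
  shows "free_map A (\<lambda>(t, x). (t, g x)) \<phi> \<in> tensor_relations A T N"
proof -
  interpret T: module A T by fact
  interpret M: module A M by fact
  interpret N: module A N by fact
  note A = T.is_cring
  note FM = tensor_free_module[OF A, of T M] and FN = tensor_free_module[OF A, of T N]
  interpret FM: module A "tensor_free A T M" by (rule FM)
  let ?f = "free_map A (\<lambda>(t, x). (t, g x))"
  note f = tensor_free_map_linear[OF A g, of T]
  note gs = linear_maps_closed[OF g] linear_maps_add[OF g] linear_maps_smult[OF g]
  note fs = linear_maps_diff[OF FM FN f] linear_maps_add[OF f] linear_maps_smult[OF f]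
    free_map_basis[OF A] tensor_basis_closed[OF A]
  have "tensor_relations A T M \<subseteq> {\<phi> \<in> carrier (tensor_free A T M). ?f \<phi> \<in> tensor_relations A T N}"
    by (rule tensor_relations_least[OF
          submodule_vimage[OF FM FN f tensor_relations_submodule[OF T N]]])
      (simp_all add: fs gs tensor_relationsI FM.minus_closed)
  with assms(5) show ?thesis by blast
qed

lemma tensor_map_coset:
  assumes T: "module A T" and M: "module A M" and N: "module A N" and g: "g \<in> linear_maps A M N"
    and \<phi>: "\<phi> \<in> carrier (tensor_free A T M)"
  shows "tensor_map A T N g (tensor_relations A T M +>\<^bsub>tensor_free A T M\<^esub> \<phi>) =
    tensor_relations A T N +>\<^bsub>tensor_free A T N\<^esub> free_map A (\<lambda>(t, x). (t, g x)) \<phi>"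
proof -
  have A: "cring A" using T by (simp add: module_def)
  show ?thesis unfolding tensor_map_def
    by (rule quot_map_coset[OF tensor_free_module[OF A] tensor_relations_submodule[OF T M]
          tensor_free_module[OF A] tensor_relations_submodule[OF T N]
          tensor_free_map_linear[OF A g] tensor_free_map_relations[OF T M N g] \<phi>])
qed

lemma tensor_map_linear:
  assumes T: "module A T" and M: "module A M" and N: "module A N" and g: "g \<in> linear_maps A M N"
  shows "tensor_map A T N g \<in> linear_maps A (tensor_module A T M) (tensor_module A T N)"
proof -
  have A: "cring A" using T by (simp add: module_def)
  show ?thesis unfolding tensor_map_def tensor_module_def
    by (rule quot_map_linear[OF tensor_free_module[OF A] tensor_relations_submodule[OF T M]
          tensor_free_module[OF A] tensor_relations_submodule[OF T N]
          tensor_free_map_linear[OF A g] tensor_free_map_relations[OF T M N g]])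
qed

text \<open>This is the relation of the fourth kind with both the scalar and the element of
  \<open>N\<close> equal to zero: its left term is (x, 0) and its right term vanishes.\<close>

lemma tensor_basis_zero:
  assumes M: "module A M" and N: "module A N" and x: "x \<in> carrier M"
  shows "free_basis A (x, \<zero>\<^bsub>N\<^esub>) \<in> tensor_relations A M N"
proof -
  interpret M: module A M by fact
  interpret N: module A N by fact
  note F = tensor_free_module[OF M.is_cring, of M N]
  interpret F: module A "tensor_free A M N" by (rule F)
  note e = tensor_basis_closed[OF M.is_cring x N.zero_closed]
  have "free_basis A (x, \<zero>\<^bsub>N\<^esub>) \<ominus>\<^bsub>tensor_free A M N\<^esub> (\<zero>\<^bsub>A\<^esub> \<odot>\<^bsub>tensor_free A M N\<^esub> free_basis A (x, \<zero>\<^bsub>N\<^esub>))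
      \<in> tensor_relations A M N"
    using tensor_relationsI(4)[OF M.R.zero_closed x N.zero_closed] by simp
  moreover have "\<ominus>\<^bsub>tensor_free A M N\<^esub> \<zero>\<^bsub>tensor_free A M N\<^esub> = \<zero>\<^bsub>tensor_free A M N\<^esub>"
    by (rule F.minus_equality) auto
  ultimately show ?thesis using e by (simp add: F.minus_eq)
qed

lemma tensor_complex_is_complex:
  assumes T: "module A T" and X: "is_complex A X"
  shows "is_complex A (tensor_complex A T X)"
proof -
  have M: "module A (obj X i)" and d: "diff X i \<in> linear_maps A (obj X i) (obj X (i + 1))" for i
    using X by (auto simp: is_complex_def)
  have A: "cring A" using T by (simp add: module_def)
  note F = tensor_free_module[OF A] and R = tensor_relations_submodule[OF T M]
  have dd: "tensor_map A T (obj X (i + 1 + 1)) (diff X (i + 1)) (tensor_map A T (obj X (i + 1)) (diff X i) w)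
      = \<zero>\<^bsub>tensor_module A T (obj X (i + 1 + 1))\<^esub>"
    if w: "w \<in> carrier (tensor_module A T (obj X i))" for i w
  proof -
    obtain \<phi> where \<phi>: "\<phi> \<in> carrier (tensor_free A T (obj X i))"
      "w = tensor_relations A T (obj X i) +>\<^bsub>tensor_free A T (obj X i)\<^esub> \<phi>"
      using w by (auto simp: tensor_module_def carrier_quot_module[OF F R])
    let ?f = "\<lambda>i. free_map A (\<lambda>(t, x). (t, diff X i x))"
    note f = tensor_free_map_linear[OF A d, where T = T]
    \<comment> \<open>The composite of two differentials is tested on the basis: (t, x) goes to (t,
      0), which is a relation by \<open>tensor_basis_zero\<close>.\<close>
    have "carrier (tensor_free A T (obj X i)) \<subseteq> {\<phi> \<in> carrier (tensor_free A T (obj X i)).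
        ?f (i + 1) (?f i \<phi>) \<in> tensor_relations A T (obj X (i + 1 + 1))}"
      unfolding tensor_free_def
      by (rule free_module_subset[OF A])
        (use submodule_vimage[OF F F linear_maps_comp[OF f f] R] X tensor_basis_zero[OF T M]
          free_basis_closed[OF A SigmaI] in
          \<open>auto simp: tensor_free_def free_map_basis[OF A] is_complex_def\<close>)
    with \<phi> have "?f (i + 1) (?f i \<phi>) \<in> tensor_relations A T (obj X (i + 1 + 1))" by blast
    then show ?thesis
      using coset_eq_submodule_iff[OF F R linear_maps_closed[OF f linear_maps_closed[OF f \<phi>(1)]]]
      by (simp only: \<phi>(2) tensor_map_coset[OF T M M d \<phi>(1)] tensor_module_def zero_quot_module[OF F R]
          tensor_map_coset[OF T M M d linear_maps_closed[OF f \<phi>(1)]])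
  qed
  show ?thesis unfolding is_complex_def
    using dd tensor_module_module[OF T M] tensor_map_linear[OF T M M d]
    by (simp add: tensor_complex_def)
qed

text \<open>The universal property of the tensor product, phrased on the free module: bilinearity
  says precisely that the lift kills the four kinds of generators. Later arguments work with this
  lift and never form the induced map on cosets.\<close>

lemma bilinear_lift_tensor_relations:
  assumes M: "module A M" and N: "module A N" and G: "module A G"
    and closed: "\<And>x y. x \<in> carrier M \<Longrightarrow> y \<in> carrier N \<Longrightarrow> \<beta> x y \<in> carrier G"
    and "\<And>x x' y. x \<in> carrier M \<Longrightarrow> x' \<in> carrier M \<Longrightarrow> y \<in> carrier N
      \<Longrightarrow> \<beta> (x \<oplus>\<^bsub>M\<^esub> x') y = \<beta> x y \<oplus>\<^bsub>G\<^esub> \<beta> x' y"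
    and "\<And>x y y'. x \<in> carrier M \<Longrightarrow> y \<in> carrier N \<Longrightarrow> y' \<in> carrier N
      \<Longrightarrow> \<beta> x (y \<oplus>\<^bsub>N\<^esub> y') = \<beta> x y \<oplus>\<^bsub>G\<^esub> \<beta> x y'"
    and "\<And>a x y. a \<in> carrier A \<Longrightarrow> x \<in> carrier M \<Longrightarrow> y \<in> carrier N
      \<Longrightarrow> \<beta> (a \<odot>\<^bsub>M\<^esub> x) y = a \<odot>\<^bsub>G\<^esub> \<beta> x y"
    and "\<And>a x y. a \<in> carrier A \<Longrightarrow> x \<in> carrier M \<Longrightarrow> y \<in> carrier N
      \<Longrightarrow> \<beta> x (a \<odot>\<^bsub>N\<^esub> y) = a \<odot>\<^bsub>G\<^esub> \<beta> x y"
    and "\<phi> \<in> tensor_relations A M N"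
  shows "free_lift A G (case_prod \<beta>) \<phi> = \<zero>\<^bsub>G\<^esub>"
proof -
  interpret M: module A M by fact
  interpret N: module A N by fact
  interpret G: module A G by fact
  note A = M.is_cring
  note F = tensor_free_module[OF A, of M N]
  interpret F: module A "tensor_free A M N" by (rule F)
  let ?l = "free_lift A G (case_prod \<beta>)"
  have \<beta>: "case_prod \<beta> \<in> carrier M \<times> carrier N \<rightarrow> carrier G" using closed by auto
  have l: "?l \<in> linear_maps A (tensor_free A M N) G"
    unfolding tensor_free_def by (rule free_lift_linear[OF G \<beta>])
  note basis = tensor_basis_closed[OF A, of _ M _ N]
  have lb: "?l (free_basis A (x, y)) = \<beta> x y" if "x \<in> carrier M" "y \<in> carrier N" for x y
    using that by (simp add: free_lift_basis[OF G \<beta>])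
  have "tensor_relations A M N \<subseteq> {\<phi> \<in> carrier (tensor_free A M N). ?l \<phi> = \<zero>\<^bsub>G\<^esub>}"
    by (rule tensor_relations_least[OF submodule_kernel[OF F G l]])
      (simp_all add: linear_maps_diff[OF F G l] linear_maps_add[OF l] linear_maps_smult[OF l]
        basis lb assms(4-8) F.minus_closed G.minus_eq G.r_neg)
  with assms(9) show ?thesis by blast
qed

section \<open>Adic completion\<close>

lemma ideal_power_ideal:
  assumes "cring A" "ideal I A" shows "ideal (ideal_power A I n) A"
proof -
  interpret cring A by fact
  show ?thesis by (induction n) (simp_all add: oneideal ideal_prod_is_ideal assms(2))
qed

lemma ideal_power_Suc_subset:
  assumes "cring A" "ideal I A" shows "ideal_power A I (Suc n) \<subseteq> ideal_power A I n"
proof -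
  interpret cring A by fact
  show ?thesis using ideal_prod_inter[OF assms(2) ideal_power_ideal[OF assms]] by simp
qed

lemma ideal_power_closed:
  "cring A \<Longrightarrow> ideal I A \<Longrightarrow> a \<in> ideal_power A I n \<Longrightarrow> a \<in> carrier A"
  using ideal.Icarr ideal_power_ideal by metis

lemma adic_submodule_submodule:
  assumes "ideal I A" "module A M"
  shows "submodule (adic_submodule A I M n) A M"
proof -
  interpret M: module A M by fact
  show ?thesis unfolding adic_submodule_def
    by (rule submodule_span_submodule[OF assms(2)])
      (auto intro!: M.smult_closed ideal_power_closed[OF M.is_cring assms(1)])
qed

lemma adic_submodule_Suc_subset:
  assumes "cring A" "ideal I A"
  shows "adic_submodule A I M (Suc n) \<subseteq> adic_submodule A I M n"
  unfolding adic_submodule_def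
  by (rule submodule_span_mono) (use ideal_power_Suc_subset[OF assms] in blast)

text \<open>Linear maps are automatically continuous for the adic topologies, which makes completion
  a functor.\<close>

lemma linear_maps_adic_submodule:
  assumes I: "ideal I A" and M: "module A M" and N: "module A N" and f: "f \<in> linear_maps A M N"
    and x: "x \<in> adic_submodule A I M n"
  shows "f x \<in> adic_submodule A I N n"
proof -
  interpret M: module A M by fact
  interpret N: module A N by fact
  note closed = ideal_power_closed[OF M.is_cring I]
  have "a \<odot>\<^bsub>N\<^esub> f y \<in> submodule_span A N {a \<odot>\<^bsub>N\<^esub> y | a y. a \<in> ideal_power A I n \<and> y \<in> carrier N}"
    if "a \<in> ideal_power A I n" "y \<in> carrier M" for a y
    using that linear_maps_closed[OF f] by (intro submodule_span_superset) blast
  with x show ?thesis unfolding adic_submodule_def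
    by (elim submodule_span_image[OF M N f, rotated 3])
      (auto simp: linear_maps_smult[OF f] closed intro!: M.smult_closed N.smult_closed closed)
qed

text \<open>The operations are levelwise, so the identities hold at each level; linearity of the
  transition maps keeps compatible sequences closed under the operations.\<close>

lemma inverse_limit_module:
  assumes A: "cring A" and L: "\<And>n. module A (L n)"
    and t: "\<And>n. t n \<in> linear_maps A (L (Suc n)) (L n)"
  shows "module A (mk_module {s. (\<forall>n. s n \<in> carrier (L n)) \<and> (\<forall>n. t n (s (Suc n)) = s n)}
    (\<lambda>n. \<zero>\<^bsub>L n\<^esub>) (\<lambda>s s' n. s n \<oplus>\<^bsub>L n\<^esub> s' n) (\<lambda>a s n. a \<odot>\<^bsub>L n\<^esub> s n))" (is "module A ?P")
proof -
  interpret cring A by fact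
  interpret L: module A "L n" for n by (rule L)
  note ts = linear_maps_add[OF t] linear_maps_smult[OF t] linear_maps_zero[OF L L t]
    linear_maps_minus[OF L L t]
  have "\<exists>s'\<in>carrier ?P. s' \<oplus>\<^bsub>?P\<^esub> s = \<zero>\<^bsub>?P\<^esub>" if "s \<in> carrier ?P" for s
    by (rule bexI[of _ "\<lambda>n. \<ominus>\<^bsub>L n\<^esub> s n"]) (use that in \<open>auto simp: ts L.l_neg\<close>)
  then have "abelian_group ?P"
    by (intro abelian_groupI) (auto simp: ts L.a_ac)
  then show ?thesis
    by (rule moduleI[OF A]) (auto simp: ts L.smult_l_distr L.smult_r_distr L.smult_assoc1)
qed

section \<open>Completion of modules and of complexes\<close>

lemma completion_eq:
  "completion A I M = mk_module
    {s. (\<forall>n. s n \<in> carrier (quot_module M (adic_submodule A I M n))) \<and>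
        (\<forall>n. quot_map M (adic_submodule A I M n) id (s (Suc n)) = s n)}
    (\<lambda>n. \<zero>\<^bsub>quot_module M (adic_submodule A I M n)\<^esub>)
    (\<lambda>s t n. s n \<oplus>\<^bsub>quot_module M (adic_submodule A I M n)\<^esub> t n)
    (\<lambda>a s n. a \<odot>\<^bsub>quot_module M (adic_submodule A I M n)\<^esub> s n)"
  by (simp add: completion_def Let_def)

context
  fixes A :: "('a, 'r) ring_scheme" and I :: "'a set"
  assumes A: "cring A" and I: "ideal I A"
begin

lemma adic_transition:
  assumes "module A M"
  shows "quot_map M (adic_submodule A I M n) id
    \<in> linear_maps A (quot_module M (adic_submodule A I M (Suc n))) (quot_module M (adic_submodule A I M n))"
  using adic_submodule_Suc_subset[OF A I, of M n]
  by (intro quot_map_linear adic_submodule_submodule[OF I] linear_maps_id assms) auto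

lemma adic_transition_coset:
  assumes "module A M" "x \<in> carrier M"
  shows "quot_map M (adic_submodule A I M n) id (adic_submodule A I M (Suc n) +>\<^bsub>M\<^esub> x)
    = adic_submodule A I M n +>\<^bsub>M\<^esub> x"
  using adic_submodule_Suc_subset[OF A I, of M n]
    quot_map_coset[OF assms(1) adic_submodule_submodule[OF I assms(1)] assms(1)
      adic_submodule_submodule[OF I assms(1)] linear_maps_id _ assms(2)]
  by auto

lemma completion_module: "module A M \<Longrightarrow> module A (completion A I M)"
  unfolding completion_eq
  by (intro inverse_limit_module A quot_module_module adic_submodule_submodule I adic_transition)

text \<open>A sequence whose k-th step lies in I^k M is Cauchy and defines a point of the
  completion. Convergent series enter the proof through this rule.\<close>

lemma completion_mapI:
  assumes "module A M" "\<And>n. x n \<in> carrier M" "\<And>n. x (Suc n) \<ominus>\<^bsub>M\<^esub> x n \<in> adic_submodule A I M n"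
  shows "(\<lambda>n. adic_submodule A I M n +>\<^bsub>M\<^esub> x n) \<in> carrier (completion A I M)"
  using assms(2) coset_in_quot_module[OF assms(1) adic_submodule_submodule[OF I assms(1)]]
    coset_eqI[OF assms(1) adic_submodule_submodule[OF I assms(1)] assms(2,2,3)]
  by (auto simp: completion_eq adic_transition_coset[OF assms(1)])

lemma completion_map_coset:
  assumes M: "module A M" and N: "module A N" and f: "f \<in> linear_maps A M N"
    and s: "s n = adic_submodule A I M n +>\<^bsub>M\<^esub> x" and x: "x \<in> carrier M"
  shows "completion_map A I N f s n = adic_submodule A I N n +>\<^bsub>N\<^esub> f x"
  unfolding completion_map_def s
  by (rule quot_map_coset[OF M adic_submodule_submodule[OF I M] N adic_submodule_submodule[OF I N] f
        linear_maps_adic_submodule[OF I M N f] x])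

text \<open>The representative depends on the level \<open>n\<close>; one that serves all levels
  exists only for points in the image of \<open>completion_unit\<close>.\<close>

lemma completionE:
  assumes "module A M" "s \<in> carrier (completion A I M)"
  obtains x where "x \<in> carrier M" "s n = adic_submodule A I M n +>\<^bsub>M\<^esub> x"
proof -
  have "s n \<in> carrier (quot_module M (adic_submodule A I M n))"
    using assms(2) by (simp add: completion_eq)
  then show ?thesis
    using that unfolding carrier_quot_module[OF assms(1) adic_submodule_submodule[OF I assms(1)]]
    by blast
qed

lemma completion_map_linear:
  assumes M: "module A M" and N: "module A N" and f: "f \<in> linear_maps A M N"
  shows "completion_map A I N f \<in> linear_maps A (completion A I M) (completion A I N)"
proof (rule linear_mapsI)
  note K = adic_submodule_submodule[OF I M] and L = adic_submodule_submodule[OF I N]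
  have q: "quot_map N (adic_submodule A I N n) f
    \<in> linear_maps A (quot_module M (adic_submodule A I M n)) (quot_module N (adic_submodule A I N n))" for n
    by (rule quot_map_linear[OF M K N L f linear_maps_adic_submodule[OF I M N f]])
  fix s assume s: "s \<in> carrier (completion A I M)"
  show "completion_map A I N f s \<in> carrier (completion A I N)"
  proof -
    have "quot_map N (adic_submodule A I N n) id (completion_map A I N f s (Suc n)) = completion_map A I N f s n" for n
    proof -
      \<comment> \<open>By compatibility of \<open>s\<close>, a representative at level n + 1 also
        serves at level n, so both levels can be computed from the same \<open>x\<close>.\<close>
      obtain x where x: "x \<in> carrier M" "s (Suc n) = adic_submodule A I M (Suc n) +>\<^bsub>M\<^esub> x"
        using completionE[OF M s] by blast
      have "s n = quot_map M (adic_submodule A I M n) id (s (Suc n))"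
        using s by (simp add: completion_eq)
      also have "\<dots> = adic_submodule A I M n +>\<^bsub>M\<^esub> x"
        by (simp only: x adic_transition_coset[OF M x(1)])
      finally have sn: "s n = adic_submodule A I M n +>\<^bsub>M\<^esub> x" .
      show ?thesis
        unfolding completion_map_coset[where s = s, OF M N f sn x(1)]
          completion_map_coset[where s = s, OF M N f x(2,1)]
        by (rule adic_transition_coset[OF N linear_maps_closed[OF f x(1)]])
    qed
    moreover have "completion_map A I N f s n \<in> carrier (quot_module N (adic_submodule A I N n))" for n
      using s linear_maps_closed[OF q] by (simp add: completion_eq completion_map_def)
    ultimately show ?thesis by (simp add: completion_eq)
  qed
  show "completion_map A I N f (a \<odot>\<^bsub>completion A I M\<^esub> s) = a \<odot>\<^bsub>completion A I N\<^esub> completion_map A I N f s"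
    if "a \<in> carrier A" for a
    using that s by (simp add: completion_eq completion_map_def linear_maps_smult[OF q])
  show "completion_map A I N f (s \<oplus>\<^bsub>completion A I M\<^esub> t)
      = completion_map A I N f s \<oplus>\<^bsub>completion A I N\<^esub> completion_map A I N f t"
    if "t \<in> carrier (completion A I M)" for t
    using that s by (simp add: completion_eq completion_map_def linear_maps_add[OF q])
qed

lemma completion_complex_is_complex:
  assumes X: "is_complex A X"
  shows "is_complex A (completion_complex A I X)"
proof -
  have M: "module A (obj X i)" and d: "diff X i \<in> linear_maps A (obj X i) (obj X (i + 1))"
    and dd: "x \<in> carrier (obj X i) \<Longrightarrow> diff X (i + 1) (diff X i x) = \<zero>\<^bsub>obj X (i + 1 + 1)\<^esub>" for i x
    using X by (auto simp: is_complex_def)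
  have "completion_map A I (obj X (i + 1 + 1)) (diff X (i + 1)) (completion_map A I (obj X (i + 1)) (diff X i) s)
      = \<zero>\<^bsub>completion A I (obj X (i + 1 + 1))\<^esub>"
    if s: "s \<in> carrier (completion A I (obj X i))" for i s
  proof
    fix n
    obtain x where x: "x \<in> carrier (obj X i)" "s n = adic_submodule A I (obj X i) n +>\<^bsub>obj X i\<^esub> x"
      using completionE[OF M s] by blast
    have "completion_map A I (obj X (i + 1 + 1)) (diff X (i + 1)) (completion_map A I (obj X (i + 1)) (diff X i) s) n
      = adic_submodule A I (obj X (i + 1 + 1)) n +>\<^bsub>obj X (i + 1 + 1)\<^esub> \<zero>\<^bsub>obj X (i + 1 + 1)\<^esub>"
      unfolding dd[OF x(1), symmetric]
      by (rule completion_map_coset[where x = "diff X i x", OF M M d])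
        (rule completion_map_coset[where s = s, OF M M d x(2,1)] linear_maps_closed[OF d x(1)])+
    then show "completion_map A I (obj X (i + 1 + 1)) (diff X (i + 1)) (completion_map A I (obj X (i + 1)) (diff X i) s) n
      = \<zero>\<^bsub>completion A I (obj X (i + 1 + 1))\<^esub> n"
      by (simp only: completion_eq mk_module_simps coset_zero[OF M adic_submodule_submodule[OF I M]]
          zero_quot_module[OF M adic_submodule_submodule[OF I M]])
  qed
  then show ?thesis unfolding is_complex_def
    using completion_module[OF M] completion_map_linear[OF M M d]
    by (simp add: completion_complex_def)
qed

end

section \<open>Cohomology and the derived category\<close>

lemma complex_module: "is_complex A X \<Longrightarrow> module A (obj X i)"
  and complex_diff: "is_complex A X \<Longrightarrow> diff X i \<in> linear_maps A (obj X i) (obj X (i + 1))"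
  and complex_diff_diff: "is_complex A X \<Longrightarrow> x \<in> carrier (obj X i)
    \<Longrightarrow> diff X (i + 1) (diff X i x) = \<zero>\<^bsub>obj X (i + 1 + 1)\<^esub>"
  by (auto simp: is_complex_def)

lemma complex_diff_pred:
  "is_complex A X \<Longrightarrow> diff X (i - 1) \<in> linear_maps A (obj X (i - 1)) (obj X i)"
  using complex_diff[of A X "i - 1"] by simp

lemma cocycles_submodule:
  assumes "is_complex A X" shows "submodule (cocycles X i) A (obj X i)"
  unfolding cocycles_def
  by (rule submodule_kernel[OF complex_module[OF assms] complex_module[OF assms] complex_diff[OF assms]])

lemma coboundaries_submodule:
  assumes "is_complex A X" shows "submodule (coboundaries X i) A (obj X i)"
  unfolding coboundaries_def
  by (rule submodule_image[OF complex_module[OF assms] complex_module[OF assms] complex_diff_pred[OF assms]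
        module.carrier_is_submodule[OF complex_module[OF assms]]])

lemma coboundaries_subset_cocycles:
  assumes "is_complex A X" shows "coboundaries X i \<subseteq> cocycles X i"
  using complex_diff_diff[OF assms, of _ "i - 1"] linear_maps_closed[OF complex_diff_pred[OF assms]]
  by (auto simp: coboundaries_def cocycles_def)

text \<open>Cutting the carrier down to the cocycles leaves the addition unchanged, so cosets of the
  coboundaries may be formed in the whole module.\<close>

lemma carrier_cohomology:
  "carrier (cohomology X i) = (\<lambda>z. coboundaries X i +>\<^bsub>obj X i\<^esub> z) ` cocycles X i"
  by (auto simp: cohomology_def quot_module_def A_RCOSETS_def' a_r_coset_def')

lemma zero_cohomology: "\<zero>\<^bsub>cohomology X i\<^esub> = coboundaries X i"
  by (simp add: cohomology_def quot_module_def)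

text \<open>From here on, vanishing of cohomology is handled as an inclusion of sets; the reverse
  inclusion holds in every complex.\<close>

lemma cohomology_trivial_iff:
  assumes X: "is_complex A X"
  shows "carrier (cohomology X i) = {\<zero>\<^bsub>cohomology X i\<^esub>} \<longleftrightarrow> cocycles X i \<subseteq> coboundaries X i"
proof -
  note iff = coset_eq_submodule_iff[OF complex_module[OF X] coboundaries_submodule[OF X]]
  have "\<zero>\<^bsub>obj X i\<^esub> \<in> cocycles X i" by (rule submodule_zero[OF cocycles_submodule[OF X]])
  moreover have "coboundaries X i +>\<^bsub>obj X i\<^esub> z = coboundaries X i \<longleftrightarrow> z \<in> coboundaries X i"
    if "z \<in> cocycles X i" for z
    using that by (intro iff) (simp add: cocycles_def)
  ultimately show ?thesis unfolding carrier_cohomology zero_cohomology by blast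
qed

section \<open>Chain maps, quasi-isomorphisms and homotopies on elements\<close>

lemma chain_map_linear: "chain_map A X Y f \<Longrightarrow> f i \<in> linear_maps A (obj X i) (obj Y i)"
  and chain_map_diff: "chain_map A X Y f \<Longrightarrow> x \<in> carrier (obj X i) \<Longrightarrow> f (i + 1) (diff X i x) = diff Y i (f i x)"
  by (auto simp: chain_map_def)

lemma chain_map_cocycles:
  assumes "is_complex A X" "is_complex A Y" "chain_map A X Y f" "x \<in> cocycles X i"
  shows "f i x \<in> cocycles Y i"
  using assms(4) linear_maps_closed[OF chain_map_linear[OF assms(3)]] chain_map_diff[OF assms(3), of x i]
    linear_maps_zero[OF complex_module[OF assms(1)] complex_module[OF assms(2)] chain_map_linear[OF assms(3)]]
  by (simp add: cocycles_def)

lemma chain_map_coboundaries: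
  assumes "chain_map A X Y f" "x \<in> coboundaries X i"
  shows "f i x \<in> coboundaries Y i"
proof -
  obtain y where y: "y \<in> carrier (obj X (i - 1))" "x = diff X (i - 1) y"
    using assms(2) by (auto simp: coboundaries_def)
  then have "f i x = diff Y (i - 1) (f (i - 1) y)" using chain_map_diff[OF assms(1) y(1)] by simp
  then show ?thesis
    using linear_maps_closed[OF chain_map_linear[OF assms(1)] y(1)] by (simp add: coboundaries_def)
qed

lemma chain_map_cohomology:
  assumes X: "is_complex A X" and Y: "is_complex A Y" and f: "chain_map A X Y f"
    and "x \<in> carrier (obj X i)"
  shows "quot_map (obj Y i) (coboundaries Y i) (f i) (coboundaries X i +>\<^bsub>obj X i\<^esub> x)
    = coboundaries Y i +>\<^bsub>obj Y i\<^esub> f i x"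
  by (rule quot_map_coset[OF complex_module[OF X] coboundaries_submodule[OF X] complex_module[OF Y]
        coboundaries_submodule[OF Y] chain_map_linear[OF f] chain_map_coboundaries[OF f] assms(4)])

text \<open>Together with \<open>quasi_iso_inj\<close> this reads the bijection on cohomology in
  terms of cocycles, which spares the later arguments any work with classes.\<close>

lemma quasi_iso_surj:
  assumes X: "is_complex A X" and Y: "is_complex A Y" and f: "quasi_iso A X Y f"
    and z: "z \<in> cocycles Y i"
  obtains x where "x \<in> cocycles X i" "z \<ominus>\<^bsub>obj Y i\<^esub> f i x \<in> coboundaries Y i"
proof -
  have cf: "chain_map A X Y f" using f by (simp add: quasi_iso_def)
  have "coboundaries Y i +>\<^bsub>obj Y i\<^esub> z \<in> quot_map (obj Y i) (coboundaries Y i) (f i) ` carrier (cohomology X i)"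
    using f z by (auto simp: quasi_iso_def bij_betw_def carrier_cohomology[of Y])
  then obtain x where x: "x \<in> cocycles X i"
    and eq: "coboundaries Y i +>\<^bsub>obj Y i\<^esub> z
      = quot_map (obj Y i) (coboundaries Y i) (f i) (coboundaries X i +>\<^bsub>obj X i\<^esub> x)"
    by (auto simp: carrier_cohomology)
  have xc: "x \<in> carrier (obj X i)" and zc: "z \<in> carrier (obj Y i)" using x z by (auto simp: cocycles_def)
  show thesis
    using that[OF x] eq
      coset_eq_iff[OF complex_module[OF Y] coboundaries_submodule[OF Y] zc
        linear_maps_closed[OF chain_map_linear[OF cf] xc]]
    unfolding chain_map_cohomology[OF X Y cf xc] by blast
qed

lemma quasi_iso_inj:
  assumes X: "is_complex A X" and Y: "is_complex A Y" and f: "quasi_iso A X Y f"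
    and x: "x \<in> cocycles X i" and fx: "f i x \<in> coboundaries Y i"
  shows "x \<in> coboundaries X i"
proof -
  have cf: "chain_map A X Y f" using f by (simp add: quasi_iso_def)
  let ?q = "quot_map (obj Y i) (coboundaries Y i) (f i)"
  note BX = coset_eq_submodule_iff[OF complex_module[OF X] coboundaries_submodule[OF X]]
  note BY = coset_eq_submodule_iff[OF complex_module[OF Y] coboundaries_submodule[OF Y]]
  have *: "?q (coboundaries X i +>\<^bsub>obj X i\<^esub> y) = coboundaries Y i"
    if "y \<in> cocycles X i" "f i y \<in> coboundaries Y i" for y
  proof -
    have y: "y \<in> carrier (obj X i)" using that by (simp add: cocycles_def)
    show ?thesis unfolding chain_map_cohomology[OF X Y cf y]
      using that(2) BY linear_maps_closed[OF chain_map_linear[OF cf] y] by blast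
  qed
  have zX: "\<zero>\<^bsub>obj X i\<^esub> \<in> cocycles X i" by (rule submodule_zero[OF cocycles_submodule[OF X]])
  have "f i \<zero>\<^bsub>obj X i\<^esub> \<in> coboundaries Y i"
    using linear_maps_zero[OF complex_module[OF X] complex_module[OF Y] chain_map_linear[OF cf]]
      submodule_zero[OF coboundaries_submodule[OF Y]] by simp
  \<comment> \<open>Injectivity of the map on classes is applied to the classes of \<open>x\<close>
    and of zero.\<close>
  then have "?q (coboundaries X i +>\<^bsub>obj X i\<^esub> x) = ?q (coboundaries X i +>\<^bsub>obj X i\<^esub> \<zero>\<^bsub>obj X i\<^esub>)"
    using *[OF x fx] *[OF zX] by simp
  moreover have "inj_on ?q (carrier (cohomology X i))"
    using f by (auto simp: quasi_iso_def bij_betw_def)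
  ultimately have "coboundaries X i +>\<^bsub>obj X i\<^esub> x = coboundaries X i +>\<^bsub>obj X i\<^esub> \<zero>\<^bsub>obj X i\<^esub>"
    unfolding carrier_cohomology using x zX by (metis inj_onD imageI)
  then show ?thesis
    using BX x by (simp add: coset_zero[OF complex_module[OF X] coboundaries_submodule[OF X]] cocycles_def)
qed

text \<open>On a cocycle the summand h d of the homotopy formula vanishes, and the summand d h is a
  coboundary.\<close>

lemma homotopic_cocycle:
  assumes X: "is_complex A X" and Y: "is_complex A Y" and h: "homotopic A X Y f g"
    and g: "g i \<in> linear_maps A (obj X i) (obj Y i)" and x: "x \<in> cocycles X i"
  obtains b where "b \<in> coboundaries Y i" "f i x = g i x \<oplus>\<^bsub>obj Y i\<^esub> b"
proof -
  interpret Y: module A "obj Y i" by (rule complex_module[OF Y])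
  obtain h where h: "\<And>i. h i \<in> linear_maps A (obj X i) (obj Y (i - 1))"
    and eq: "\<And>i x. x \<in> carrier (obj X i) \<Longrightarrow>
      f i x = g i x \<oplus>\<^bsub>obj Y i\<^esub> (diff Y (i - 1) (h i x) \<oplus>\<^bsub>obj Y i\<^esub> h (i + 1) (diff X i x))"
    using h by (auto simp: homotopic_def)
  have xc: "x \<in> carrier (obj X i)" and dx: "diff X i x = \<zero>\<^bsub>obj X (i + 1)\<^esub>"
    using x by (auto simp: cocycles_def)
  have b: "diff Y (i - 1) (h i x) \<in> coboundaries Y i"
    using linear_maps_closed[OF h xc] by (simp add: coboundaries_def)
  have "h (i + 1) \<zero>\<^bsub>obj X (i + 1)\<^esub> = \<zero>\<^bsub>obj Y i\<^esub>"
    using linear_maps_zero[OF complex_module[OF X] complex_module[OF Y] h, of "i + 1"] by simp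
  with eq[OF xc] dx submodule_subset[OF coboundaries_submodule[OF Y] b]
  have "f i x = g i x \<oplus>\<^bsub>obj Y i\<^esub> diff Y (i - 1) (h i x)" by simp
  with b show thesis by (rule that)
qed

text \<open>The fraction g s^(-1) is a left inverse of \<open>f\<close> on cohomology, and the proof
  follows one class around. The cocycle \<open>z\<close> is cohomologous to some
  \<open>u i c\<close>; then \<open>s i (h i c)\<close> is cohomologous to
  \<open>f i (u i c)\<close>, a coboundary, so \<open>h i c\<close> is a coboundary because
  \<open>s\<close> is a quasi-isomorphism. Hence \<open>g i (h i c)\<close> is one, and it is
  cohomologous to \<open>u i c\<close>.\<close>

lemma derived_isomorphism_inj:
  assumes X: "is_complex A X" and Y: "is_complex A Y" and f: "derived_isomorphism A X Y f"
    and z: "z \<in> cocycles X i" and fz: "f i z \<in> coboundaries Y i"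
  shows "z \<in> coboundaries X i"
proof -
  obtain R U :: "('a, 'c) cochain_complex" and s g u h where
    f: "chain_map A X Y f" and R: "is_complex A R" and s: "quasi_iso A R Y s" and g: "chain_map A R X g"
    and U: "is_complex A U" and u: "quasi_iso A U X u" and h: "chain_map A U R h"
    and sh: "homotopic A U Y (\<lambda>i x. s i (h i x)) (\<lambda>i x. f i (u i x))"
    and gh: "homotopic A U X (\<lambda>i x. g i (h i x)) u"
    using f unfolding derived_isomorphism_def by blast
  interpret X: module A "obj X i" by (rule complex_module[OF X])
  interpret Y: module A "obj Y i" by (rule complex_module[OF Y])
  note BX = coboundaries_submodule[OF X, of i] and BY = coboundaries_submodule[OF Y, of i]
  have uc: "chain_map A U X u" using u by (simp add: quasi_iso_def)
  note fl = chain_map_linear[OF f, of i] and ul = chain_map_linear[OF uc, of i]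
  obtain c where c: "c \<in> cocycles U i" and zc: "z \<ominus>\<^bsub>obj X i\<^esub> u i c \<in> coboundaries X i"
    using quasi_iso_surj[OF U X u z] by blast
  have ucl: "u i c \<in> carrier (obj X i)" and zcl: "z \<in> carrier (obj X i)"
    using c z linear_maps_closed[OF ul] by (auto simp: cocycles_def)
  have fcl: "f i z \<in> carrier (obj Y i)" "f i (u i c) \<in> carrier (obj Y i)"
    using linear_maps_closed[OF fl] ucl zcl by auto
  have "f i z \<ominus>\<^bsub>obj Y i\<^esub> f i (u i c) \<in> coboundaries Y i"
    using chain_map_coboundaries[OF f zc] ucl zcl
    by (simp add: linear_maps_diff[OF complex_module[OF X] complex_module[OF Y] fl])
  from submodule_diff[OF BY fz this] have fuc: "f i (u i c) \<in> coboundaries Y i"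
    using fcl by (simp add: Y.minus_eq Y.minus_add Y.r_neg2)
  obtain b where b: "b \<in> coboundaries Y i" "s i (h i c) = f i (u i c) \<oplus>\<^bsub>obj Y i\<^esub> b"
    by (rule homotopic_cocycle[OF U Y sh linear_maps_comp[OF ul fl] c])
  then have "s i (h i c) \<in> coboundaries Y i" using submodule_add[OF BY fuc] by simp
  then have "h i c \<in> coboundaries R i"
    by (rule quasi_iso_inj[OF R Y s chain_map_cocycles[OF U R h c]])
  then have ghc: "g i (h i c) \<in> coboundaries X i" by (rule chain_map_coboundaries[OF g])
  obtain b' where b': "b' \<in> coboundaries X i" "g i (h i c) = u i c \<oplus>\<^bsub>obj X i\<^esub> b'"
    by (rule homotopic_cocycle[OF U X gh ul c])
  have b'c: "b' \<in> carrier (obj X i)" using submodule_subset[OF BX b'(1)] .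
  have "u i c \<in> coboundaries X i"
    using submodule_diff[OF BX ghc b'(1)] b'(2) ucl b'c by (simp add: X.minus_eq X.a_assoc X.r_neg)
  from submodule_add[OF BX zc this] show ?thesis
    using zcl ucl by (simp add: X.minus_eq X.a_assoc X.l_neg)
qed

section \<open>Zero objects of the derived category are the acyclic complexes\<close>

lemma zero_complex_is_complex:
  assumes "cring A" shows "is_complex A zero_complex"
proof -
  have "module A (mk_module {undefined} undefined (\<lambda>_ _. undefined) (\<lambda>_ _. undefined))"
    by (rule moduleI[OF assms abelian_groupI]) auto
  then show ?thesis by (auto simp: is_complex_def zero_complex_def linear_maps_def)
qed

lemma chain_map_id: "chain_map A X X (\<lambda>i x. x)"
  by (auto simp: chain_map_def linear_maps_def)

lemma quasi_iso_id:
  assumes X: "is_complex A X" shows "quasi_iso A X X (\<lambda>i x. x)"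
proof -
  have "quot_map (obj X i) (coboundaries X i) (\<lambda>x. x) w = w" if "w \<in> carrier (cohomology X i)" for i w
    using that chain_map_cohomology[OF X X chain_map_id] by (auto simp: carrier_cohomology cocycles_def)
  then show ?thesis
    by (auto simp: quasi_iso_def chain_map_id bij_betw_def inj_on_def image_iff)
qed

lemma homotopic_refl:
  assumes Y: "is_complex A Y" and f: "\<And>i. f i \<in> linear_maps A (obj X i) (obj Y i)"
  shows "homotopic A X Y f f"
proof -
  have M: "module A (obj Y i)" for i by (rule complex_module[OF Y])
  interpret Y: module A "obj Y i" for i by (rule M)
  have "(\<lambda>x. \<zero>\<^bsub>obj Y (i - 1)\<^esub>) \<in> linear_maps A (obj X i) (obj Y (i - 1))" for i
    by (auto simp: linear_maps_def)
  moreover have "f i x = f i x \<oplus>\<^bsub>obj Y i\<^esub> (diff Y (i - 1) \<zero>\<^bsub>obj Y (i - 1)\<^esub> \<oplus>\<^bsub>obj Y i\<^esub> \<zero>\<^bsub>obj Y (i + 1 - 1)\<^esub>)"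
    if "x \<in> carrier (obj X i)" for i x
    using linear_maps_closed[OF f that] linear_maps_zero[OF M M complex_diff_pred[OF Y]] by simp
  ultimately show ?thesis
    unfolding homotopic_def by (intro exI[of _ "\<lambda>i x. \<zero>\<^bsub>obj Y (i - 1)\<^esub>"]) blast
qed

text \<open>Forward, every cocycle goes to zero, which is a coboundary, and
  \<open>derived_isomorphism_inj\<close> applies. Backward, the zero map is itself a
  quasi-isomorphism: with every auxiliary complex equal to \<open>X\<close>, \<open>s\<close> the
  zero map and all other maps the identity, the required homotopies are trivial.\<close>

lemma derived_zero_iff:
  fixes X :: "('a, 'm) cochain_complex"
  assumes A: "cring A" and X: "is_complex A X"
  shows "derived_zero A X \<longleftrightarrow> (\<forall>i. cocycles X i \<subseteq> coboundaries X i)"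
proof
  let ?Z = "zero_complex :: ('a, 'm) cochain_complex"
  let ?f = "\<lambda>i x. \<zero>\<^bsub>obj ?Z i\<^esub>"
  note Z = zero_complex_is_complex[OF A]
  interpret Z: module A "obj ?Z i" for i by (rule complex_module[OF Z])
  {
    assume "derived_zero A X"
    then have "derived_isomorphism A X ?Z ?f" by (simp add: derived_zero_def)
    then show "\<forall>i. cocycles X i \<subseteq> coboundaries X i"
      using derived_isomorphism_inj[OF X Z] submodule_zero[OF coboundaries_submodule[OF Z]] by blast
  next
    assume acyclic: "\<forall>i. cocycles X i \<subseteq> coboundaries X i"
    have f: "chain_map A X ?Z ?f"
      by (auto simp: chain_map_def linear_maps_def zero_complex_def)
    have HX: "carrier (cohomology X i) = {coboundaries X i}" for i
      using cohomology_trivial_iff[OF X, of i] acyclic by (simp add: zero_cohomology)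
    have HZ: "carrier (cohomology ?Z i) = {coboundaries ?Z i}" for i
      using cohomology_trivial_iff[OF Z, of i] by (simp add: zero_cohomology coboundaries_def cocycles_def zero_complex_def)
    have "quot_map (obj ?Z i) (coboundaries ?Z i) (?f i) (coboundaries X i) = coboundaries ?Z i" for i
      using chain_map_cohomology[OF X Z f, of "\<zero>\<^bsub>obj X i\<^esub>" i]
        submodule_subset[OF coboundaries_submodule[OF X] submodule_zero[OF coboundaries_submodule[OF X]]]
      by (simp add: coset_zero[OF complex_module[OF X] coboundaries_submodule[OF X]]
          coset_zero[OF complex_module[OF Z] coboundaries_submodule[OF Z]])
    then have qf: "quasi_iso A X ?Z ?f" by (simp add: quasi_iso_def f HX HZ bij_betw_def)
    note hf = homotopic_refl[OF Z, of ?f X, OF chain_map_linear[OF f]]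
    note hX = homotopic_refl[OF X, of "\<lambda>i x. x" X, OF chain_map_linear[OF chain_map_id]]
    show "derived_zero A X" unfolding derived_zero_def derived_isomorphism_def
      by (intro conjI f exI[of _ X] exI[of _ ?f] exI[of _ "\<lambda>i x. x"] X qf chain_map_id quasi_iso_id hf hX)
  }
qed

section \<open>Splitting off the top cohomology of a K-projective complex\<close>

text \<open>A chain map is a cocycle of degree 0 in the Hom complex, hence the differential of an
  element \<open>h\<close> of degree -1. As -1 is odd, that differential is d h + h d, so
  \<open>h\<close> is a null-homotopy.\<close>

lemma K_projective_null_homotopic:
  fixes P N :: "('a, 'm) cochain_complex"
  assumes P: "K_projective A P" and N: "is_complex A N" and acyclic: "\<And>i. cocycles N i \<subseteq> coboundaries N i"
    and p: "chain_map A P N p"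
  obtains h where "\<And>i. h i \<in> linear_maps A (obj P i) (obj N (i - 1))"
    "\<And>i x. x \<in> carrier (obj P i)
      \<Longrightarrow> p i x = diff N (i - 1) (h i x) \<oplus>\<^bsub>obj N i\<^esub> h (i + 1) (diff P i x)"
proof -
  let ?H = "hom_complex A P N"
  have cP: "is_complex A P" using P by (simp add: K_projective_def)
  interpret N: module A "obj N i" for i by (rule complex_module[OF N])
  have "acyclic_complex N"
    using acyclic by (simp add: acyclic_complex_def cohomology_trivial_iff[OF N])
  then have "carrier (cohomology ?H 0) = {\<zero>\<^bsub>cohomology ?H 0\<^esub>}"
    using P N by (auto simp: K_projective_def acyclic_complex_def)
  then have triv: "coboundaries ?H 0 +>\<^bsub>obj ?H 0\<^esub> \<phi> = coboundaries ?H 0" if "\<phi> \<in> cocycles ?H 0" for \<phi>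
    using that unfolding carrier_cohomology zero_cohomology by blast
  \<comment> \<open>Elements of the Hom complex are extensional, so \<open>p\<close> has to be cut
    off outside the carriers.\<close>
  define \<phi> where "\<phi> = (\<lambda>i. restrict (p i) (carrier (obj P i)))"
  have dP: "diff P i x \<in> carrier (obj P (i + 1))" if "x \<in> carrier (obj P i)" for i x
    using linear_maps_closed[OF complex_diff[OF cP] that] .
  have "\<phi> i \<in> linear_maps A (obj P i) (obj N i)" for i
  proof -
    interpret P: module A "obj P i" by (rule complex_module[OF cP])
    show ?thesis using chain_map_linear[OF p, of i] by (auto simp: \<phi>_def linear_maps_def)
  qed
  moreover have "p (i + 1) (diff P i x) = diff N i (p i x)" "diff N i (p i x) \<in> carrier (obj N (i + 1))"
    if "x \<in> carrier (obj P i)" for i x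
    using chain_map_diff[OF p that] linear_maps_closed[OF complex_diff[OF N]
        linear_maps_closed[OF chain_map_linear[OF p] that]] by auto
  ultimately have \<phi>: "\<phi> \<in> cocycles ?H 0"
    using dP by (auto simp: cocycles_def hom_complex_def hom_module_def \<phi>_def N.minus_eq N.r_neg
        fun_eq_iff restrict_def extensional_def)
  \<comment> \<open>Acyclicity says only that the coset of \<open>\<phi>\<close> equals the set of
    coboundaries. Since the zero family \<open>?z 0\<close> is a coboundary, \<open>\<phi>\<close> =
    0 + \<open>\<phi>\<close> lies in its own coset; this avoids showing that the Hom complex is a
    complex of modules.\<close>
  let ?z = "\<lambda>n i. \<lambda>x\<in>carrier (obj P i). \<zero>\<^bsub>obj N (i + n)\<^esub>"
  have "\<phi> \<in> coboundaries ?H 0"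
  proof -
    have z: "?z n \<in> carrier (obj ?H n)" for n
    proof -
      interpret P: module A "obj P i" for i by (rule complex_module[OF cP])
      show ?thesis by (auto simp: hom_complex_def hom_module_def linear_maps_def)
    qed
    have "diff N (i - 1) \<zero>\<^bsub>obj N (i - 1)\<^esub> = \<zero>\<^bsub>obj N i\<^esub>" for i
      by (rule linear_maps_zero[OF complex_module[OF N] complex_module[OF N] complex_diff_pred[OF N]])
    then have "diff ?H (- 1) (?z (- 1)) = ?z 0"
      using dP by (auto simp: hom_complex_def fun_eq_iff restrict_def)
    then have "?z 0 \<in> coboundaries ?H 0"
      using z[of "- 1"] by (auto simp: coboundaries_def intro!: image_eqI[of _ _ "?z (- 1)"])
    moreover have "\<phi> = ?z 0 \<oplus>\<^bsub>obj ?H 0\<^esub> \<phi>"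
      using linear_maps_closed[OF chain_map_linear[OF p]]
      by (auto simp: hom_complex_def hom_module_def \<phi>_def fun_eq_iff)
    ultimately have "\<phi> \<in> coboundaries ?H 0 +>\<^bsub>obj ?H 0\<^esub> \<phi>"
      unfolding a_r_coset_def' by blast
    then show ?thesis by (simp add: triv[OF \<phi>])
  qed
  then obtain h where h: "h \<in> carrier (obj ?H (- 1))" "\<phi> = diff ?H (- 1) h"
    by (auto simp: coboundaries_def)
  show thesis
  proof
    show "h i \<in> linear_maps A (obj P i) (obj N (i - 1))" for i
      using h(1) by (simp add: hom_complex_def hom_module_def)
    show "p i x = diff N (i - 1) (h i x) \<oplus>\<^bsub>obj N i\<^esub> h (i + 1) (diff P i x)"
      if "x \<in> carrier (obj P i)" for i x
      using fun_cong[OF fun_cong[OF h(2)], of i x] that by (simp add: hom_complex_def \<phi>_def)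
  qed
qed

text \<open>
  Dividing the truncation of \<open>Q\<close> in degrees at least \<open>n\<close> by the coboundaries leaves only the
  cohomology in degree \<open>n\<close>. Putting this cohomology into degree \<open>n - 1\<close> makes the complex acyclic,
  so the projection of \<open>Q\<close> onto it is null-homotopic, and the homotopy in degree \<open>n\<close> is the
  desired retraction onto the cohomology.
\<close>

lemma K_projective_top_cohomology:
  fixes Q :: "('a, 'm) cochain_complex"
  assumes Q: "K_projective A Q" and top: "\<And>i. i > n \<Longrightarrow> cocycles Q i \<subseteq> coboundaries Q i"
  obtains g where "g \<in> linear_maps A (obj Q n) (quot_module (obj Q n) (coboundaries Q n))"
    "\<And>x. x \<in> carrier (obj Q n) \<Longrightarrow> g x \<in> (\<lambda>z. coboundaries Q n +>\<^bsub>obj Q n\<^esub> z) ` cocycles Q n"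
    "\<And>b. b \<in> coboundaries Q n \<Longrightarrow> g b = coboundaries Q n"
    "\<And>z. z \<in> cocycles Q n \<Longrightarrow> g z = coboundaries Q n +>\<^bsub>obj Q n\<^esub> z"
proof -
  have cQ: "is_complex A Q" using Q by (simp add: K_projective_def)
  note M = complex_module[OF cQ] and B = coboundaries_submodule[OF cQ, of n]
    and Z = cocycles_submodule[OF cQ, of n] and d = complex_diff[OF cQ]
  interpret M: module A "obj Q i" for i by (rule M)
  \<comment> \<open>The carrier type matters: \<open>K_projective\<close> tests only against
    complexes with the carrier type of \<open>Q\<close>, and the cosets in
    \<open>quot_module\<close> have another type.\<close>
  obtain T :: "('a, 'm) module" and \<rho> where T: "module A T" and \<rho>: "\<rho> \<in> linear_maps A (obj Q n) T"
    and surj: "carrier T = \<rho> ` carrier (obj Q n)"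
    and ker: "\<And>x. x \<in> carrier (obj Q n) \<Longrightarrow> \<rho> x = \<zero>\<^bsub>T\<^esub> \<longleftrightarrow> x \<in> coboundaries Q n"
    by (rule quotient_in_type[OF M B]) (rule that)
  interpret T: module A T by (rule T)
  have dB: "diff Q n x = \<zero>\<^bsub>obj Q (n + 1)\<^esub>" if "x \<in> coboundaries Q n" for x
    using coboundaries_subset_cocycles[OF cQ, of n] that by (auto simp: cocycles_def)
  obtain d' where d': "d' \<in> linear_maps A T (obj Q (n + 1))"
    and d'\<rho>: "\<And>x. x \<in> carrier (obj Q n) \<Longrightarrow> d' (\<rho> x) = diff Q n x"
    using linear_factor[OF M M T d \<rho> surj] ker dB by metis
  \<comment> \<open>The map \<open>\<pi>\<close> leads from the copy \<open>T\<close> back to the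
    quotient by cosets, in which the conclusion is stated.\<close>
  obtain \<pi> where \<pi>: "\<pi> \<in> linear_maps A T (quot_module (obj Q n) (coboundaries Q n))"
    and \<pi>\<rho>: "\<And>x. x \<in> carrier (obj Q n) \<Longrightarrow> \<pi> (\<rho> x) = coboundaries Q n +>\<^bsub>obj Q n\<^esub> x"
    using linear_factor[OF M quot_module_module[OF M B] T coset_linear[OF M B] \<rho> surj]
      ker coset_eq_submodule_iff[OF M B] zero_quot_module[OF M B] by metis
  have ZT: "submodule (\<rho> ` cocycles Q n) A T" by (rule submodule_image[OF M T \<rho> Z])
  note Zc = submodule_subset[OF Z] and ZTc = submodule_subset[OF ZT]
  define N where "N = \<lparr>obj = (\<lambda>i. if n < i then obj Q i else if i = n then T
      else if i = n - 1 then T\<lparr>carrier := \<rho> ` cocycles Q n\<rparr> else T\<lparr>carrier := {\<zero>\<^bsub>T\<^esub>}\<rparr>),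
    diff = (\<lambda>i. if n < i then diff Q i else if i = n then d'
      else if i = n - 1 then (\<lambda>t. t) else (\<lambda>t. \<zero>\<^bsub>T\<^esub>))\<rparr>"
  have obj: "n < i \<Longrightarrow> obj N i = obj Q i" "obj N n = T" "obj N (n - 1) = T\<lparr>carrier := \<rho> ` cocycles Q n\<rparr>"
    "i < n - 1 \<Longrightarrow> obj N i = T\<lparr>carrier := {\<zero>\<^bsub>T\<^esub>}\<rparr>" for i
    by (simp_all add: N_def)
  have diff: "n < i \<Longrightarrow> diff N i = diff Q i" "diff N n = d'" "diff N (n - 1) = (\<lambda>t. t)"
    "i < n - 1 \<Longrightarrow> diff N i = (\<lambda>t. \<zero>\<^bsub>T\<^esub>)" for i
    by (simp_all add: N_def)
  have cases: "n < i \<or> i = n \<or> i = n - 1 \<or> i < n - 1" for i by linarith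
  have zeroN: "\<zero>\<^bsub>obj N i\<^esub> = \<zero>\<^bsub>T\<^esub>" "\<zero>\<^bsub>T\<^esub> \<in> carrier (obj N i)" if "i \<le> n" for i
    using that cases[of i] submodule_zero[OF ZT] T.zero_closed by (elim disjE; simp add: obj)+
  have objN: "module A (obj N i)" for i
    using cases[of i] submodule.submodule_is_module[OF ZT T]
      submodule.submodule_is_module[OF submodule_zero_module[OF T] T]
    by (auto simp: obj M T)
  have diffN: "diff N i \<in> linear_maps A (obj N i) (obj N (i + 1))" for i
  proof (cases "i < n - 1")
    case True
    then show ?thesis
      using zeroN[of "i + 1"] module.smult_r_null[OF objN, of _ "i + 1"]
        abelian_monoid.r_zero[OF abelian_group.axioms(1)[OF module.axioms(2)[OF objN]], of _ "i + 1"]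
      by (auto simp: linear_maps_def obj diff)
  next
    case False
    with cases[of i] show ?thesis
      using d'(1) d[of i] ZTc by (auto simp: obj diff linear_maps_def)
  qed
  have "diff N (i + 1) (diff N i x) = \<zero>\<^bsub>obj N (i + 1 + 1)\<^esub>" if x: "x \<in> carrier (obj N i)" for i x
  proof -
    consider "n < i" | "i = n" | "i = n - 1" | "i = n - 1 - 1" | "i < n - 1 - 1" by linarith
    then show ?thesis
    proof cases
      case 1 then show ?thesis using x complex_diff_diff[OF cQ, of x i] by (simp add: obj diff)
    next
      case 2 then show ?thesis
        using x complex_diff_diff[OF cQ, of _ n] by (auto simp: obj diff surj d'\<rho>)
    next
      case 3
      with x obtain z where z: "z \<in> cocycles Q n" "x = \<rho> z" by (auto simp: obj)
      then have "d' x = \<zero>\<^bsub>obj Q (n + 1)\<^esub>" using d'\<rho>[OF Zc[OF z(1)]] by (simp add: cocycles_def)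
      with 3 show ?thesis by (simp add: obj diff)
    next
      case 4 then show ?thesis by (simp add: obj diff)
    next
      case 5 then show ?thesis using zeroN(1)[of "i + 1 + 1"] by (simp add: diff)
    qed
  qed
  with objN diffN have N: "is_complex A N" by (simp add: is_complex_def)
  \<comment> \<open>In degree n - 1 the inclusion is injective. In degree n the kernel of
    \<open>d'\<close> is the image of the cocycles, which is the image of the inclusion. Degree n +
    1 uses \<open>top\<close>, since \<open>d'\<close> has the same image as the differential of
    \<open>Q\<close>; above that, \<open>N\<close> agrees with \<open>Q\<close>.\<close>
  have acyclic: "cocycles N i \<subseteq> coboundaries N i" for i
  proof
    fix t assume t: "t \<in> cocycles N i"
    consider "n + 1 < i" | "i = n + 1" | "i = n" | "i = n - 1" | "i < n - 1" by linarith
    then show "t \<in> coboundaries N i"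
    proof cases
      case 1 then show ?thesis using t top[of i] by (auto simp: cocycles_def coboundaries_def obj diff)
    next
      case 2
      then have "t \<in> coboundaries Q (n + 1)" using t top[of i] by (auto simp: cocycles_def obj diff)
      then obtain x where "x \<in> carrier (obj Q n)" "t = diff Q n x" by (auto simp: coboundaries_def)
      with 2 show ?thesis by (auto simp: coboundaries_def obj diff surj d'\<rho>[symmetric])
    next
      case 3
      then show ?thesis using t by (auto simp: cocycles_def coboundaries_def obj diff surj d'\<rho>)
    next
      case 4
      then show ?thesis using t zeroN(2)[of "n - 1 - 1"]
        by (auto simp: cocycles_def coboundaries_def obj diff)
    next
      case 5
      then show ?thesis using t zeroN(2)[of "i - 1"]
        by (auto simp: cocycles_def coboundaries_def obj diff)
    qed
  qed
  define p where "p = (\<lambda>i. if n < i then (\<lambda>x. x) else if i = n then \<rho> else (\<lambda>x. \<zero>\<^bsub>T\<^esub>))"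
  have p: "chain_map A Q N p"
  proof -
    have "p i \<in> linear_maps A (obj Q i) (obj N i)" for i
    proof (cases "i < n")
      case True
      then show ?thesis
        using zeroN[of i] module.smult_r_null[OF objN, of _ i]
          abelian_monoid.r_zero[OF abelian_group.axioms(1)[OF module.axioms(2)[OF objN]], of _ i]
        by (auto simp: linear_maps_def p_def)
    next
      case False
      then show ?thesis using \<rho> linear_maps_id[of A "obj Q i"]
        by (cases "i = n") (auto simp: p_def obj linear_maps_def)
    qed
    moreover have "p (i + 1) (diff Q i x) = diff N i (p i x)" if x: "x \<in> carrier (obj Q i)" for i x
      using cases[of i]
    proof (elim disjE)
      assume "i = n - 1"
      moreover from this x have "diff Q i x \<in> coboundaries Q n" by (simp add: coboundaries_def)
      moreover from this have "\<rho> (diff Q i x) = \<zero>\<^bsub>T\<^esub>" using ker submodule_subset[OF B] by blast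
      ultimately show ?thesis by (simp add: p_def diff)
    qed (use x in \<open>auto simp: p_def diff d'\<rho>\<close>)
    ultimately show ?thesis by (simp add: chain_map_def)
  qed
  obtain h where h: "\<And>i. h i \<in> linear_maps A (obj Q i) (obj N (i - 1))"
    and eq: "\<And>i x. x \<in> carrier (obj Q i)
      \<Longrightarrow> p i x = diff N (i - 1) (h i x) \<oplus>\<^bsub>obj N i\<^esub> h (i + 1) (diff Q i x)"
    using K_projective_null_homotopic[OF Q N acyclic p] by blast
  have hn: "h n \<in> linear_maps A (obj Q n) T"
    using linear_maps_closed[OF h, of _ n] linear_maps_add[OF h, of _ n] linear_maps_smult[OF h, of _ _ n] ZTc
    by (intro linear_mapsI) (simp_all add: obj)
  \<comment> \<open>In degree n - 1 both \<open>p\<close> and the incoming differential of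
    \<open>N\<close> are zero, so the homotopy formula leaves only \<open>h n\<close> applied to a
    coboundary.\<close>
  have hB: "h n b = \<zero>\<^bsub>T\<^esub>" if b: "b \<in> coboundaries Q n" for b
  proof -
    obtain x where x: "x \<in> carrier (obj Q (n - 1))" "b = diff Q (n - 1) x"
      using b by (auto simp: coboundaries_def)
    have "\<zero>\<^bsub>T\<^esub> = \<zero>\<^bsub>T\<^esub> \<oplus>\<^bsub>T\<^esub> h n b"
      using eq[OF x(1)] x(2) by (simp add: p_def obj diff)
    then show ?thesis using linear_maps_closed[OF hn submodule_subset[OF B b]] by simp
  qed
  \<comment> \<open>In degree n the incoming differential of \<open>N\<close> is the inclusion, and
    the other summand vanishes on cocycles.\<close>
  have hZ: "h n z = \<rho> z" if z: "z \<in> cocycles Q n" for z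
  proof -
    have "h (n + 1) \<zero>\<^bsub>obj Q (n + 1)\<^esub> = \<zero>\<^bsub>T\<^esub>"
      using linear_maps_zero[OF M objN h, of "n + 1"] by (simp add: obj)
    then have "\<rho> z = h n z \<oplus>\<^bsub>T\<^esub> \<zero>\<^bsub>T\<^esub>"
      using eq[OF Zc[OF z]] z by (simp add: p_def obj diff cocycles_def)
    then show ?thesis using linear_maps_closed[OF hn Zc[OF z]] by simp
  qed
  show thesis
  proof
    show "(\<lambda>x. \<pi> (h n x)) \<in> linear_maps A (obj Q n) (quot_module (obj Q n) (coboundaries Q n))"
      by (rule linear_maps_comp[OF hn \<pi>])
    show "\<pi> (h n x) \<in> (\<lambda>z. coboundaries Q n +>\<^bsub>obj Q n\<^esub> z) ` cocycles Q n"
      if "x \<in> carrier (obj Q n)" for x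
    proof -
      have "h n x \<in> \<rho> ` cocycles Q n" using linear_maps_closed[OF h that] by (simp add: obj)
      then obtain z where "z \<in> cocycles Q n" "h n x = \<rho> z" by blast
      with \<pi>\<rho>[OF Zc] show ?thesis by auto
    qed
    show "\<pi> (h n b) = coboundaries Q n" if "b \<in> coboundaries Q n" for b
      using hB[OF that] linear_maps_zero[OF T quot_module_module[OF M B] \<pi>] zero_quot_module[OF M B] by simp
    show "\<pi> (h n z) = coboundaries Q n +>\<^bsub>obj Q n\<^esub> z" if "z \<in> cocycles Q n" for z
      using \<pi>\<rho>[OF Zc[OF that]] hZ[OF that] by simp
  qed
qed

section \<open>Nakayama's lemma in the top degree\<close>

text \<open>This is B^n + I Z^n. That it contains all cocycles means H^n = I H^n, stated without
  multiplying classes by the ideal.\<close>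

definition adic_coboundaries ::
  "('a, 'r) ring_scheme \<Rightarrow> 'a set \<Rightarrow> ('a, 'm) cochain_complex \<Rightarrow> int \<Rightarrow> 'm set" where
  "adic_coboundaries A I X n = submodule_span A (obj X n)
     (coboundaries X n \<union> {a \<odot>\<^bsub>obj X n\<^esub> z | a z. a \<in> I \<and> z \<in> cocycles X n})"

context
  fixes A :: "('a, 'r) ring_scheme" and I :: "'a set"
  assumes A: "cring A" and I: "ideal I A"
begin

lemma adic_coboundaries_generators:
  assumes X: "is_complex A X"
  shows "coboundaries X n \<union> {a \<odot>\<^bsub>obj X n\<^esub> z | a z. a \<in> I \<and> z \<in> cocycles X n} \<subseteq> cocycles X n"
  using coboundaries_subset_cocycles[OF X] submodule_smult[OF cocycles_submodule[OF X]] ideal.Icarr[OF I]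
  by blast

lemma adic_coboundaries_subset_cocycles:
  assumes X: "is_complex A X"
  shows "adic_coboundaries A I X n \<subseteq> cocycles X n"
  unfolding adic_coboundaries_def
  by (rule submodule_span_least[OF cocycles_submodule[OF X] adic_coboundaries_generators[OF X]])

lemma adic_coboundaries_generators_closed:
  assumes X: "is_complex A X"
  shows "coboundaries X n \<union> {a \<odot>\<^bsub>obj X n\<^esub> z | a z. a \<in> I \<and> z \<in> cocycles X n} \<subseteq> carrier (obj X n)"
  using adic_coboundaries_generators[OF X] submodule_subset[OF cocycles_submodule[OF X]] by blast

lemma adic_coboundaries_submodule:
  assumes X: "is_complex A X"
  shows "submodule (adic_coboundaries A I X n) A (obj X n)"
  unfolding adic_coboundaries_def
  by (rule submodule_span_submodule[OF complex_module[OF X] adic_coboundaries_generators_closed[OF X]])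

lemma adic_coboundariesI:
  "b \<in> coboundaries X n \<Longrightarrow> b \<in> adic_coboundaries A I X n"
  "a \<in> I \<Longrightarrow> z \<in> cocycles X n \<Longrightarrow> a \<odot>\<^bsub>obj X n\<^esub> z \<in> adic_coboundaries A I X n"
  unfolding adic_coboundaries_def by (rule submodule_span_superset; blast)+

lemma chain_map_adic_coboundaries:
  assumes X: "is_complex A X" and Y: "is_complex A Y" and f: "chain_map A X Y f"
    and x: "x \<in> adic_coboundaries A I X n"
  shows "f n x \<in> adic_coboundaries A I Y n"
proof -
  have "f n x \<in> adic_coboundaries A I Y n"
    if "x \<in> coboundaries X n \<union> {a \<odot>\<^bsub>obj X n\<^esub> z | a z. a \<in> I \<and> z \<in> cocycles X n}" for x
    using that chain_map_coboundaries[OF f] chain_map_cocycles[OF X Y f] ideal.Icarr[OF I]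
      submodule_subset[OF cocycles_submodule[OF X]]
    by (auto simp: linear_maps_smult[OF chain_map_linear[OF f]] adic_coboundariesI)
  with x show ?thesis unfolding adic_coboundaries_def
    by (elim submodule_span_image[OF complex_module[OF X] complex_module[OF Y] chain_map_linear[OF f]
          adic_coboundaries_generators_closed[OF X] adic_coboundaries_generators_closed[OF Y], rotated])
qed

text \<open>Each cocycle of \<open>Y\<close> is cohomologous to the image of a cocycle of
  \<open>X\<close>, and a chain map takes B^n + I Z^n of \<open>X\<close> into that of
  \<open>Y\<close>.\<close>

lemma quasi_iso_adic_coboundaries_forward:
  assumes X: "is_complex A X" and Y: "is_complex A Y" and f: "quasi_iso A X Y f"
    and sub: "cocycles X n \<subseteq> adic_coboundaries A I X n"
  shows "cocycles Y n \<subseteq> adic_coboundaries A I Y n"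
proof
  interpret Y: module A "obj Y n" by (rule complex_module[OF Y])
  have cf: "chain_map A X Y f" using f by (simp add: quasi_iso_def)
  fix z assume z: "z \<in> cocycles Y n"
  obtain x where x: "x \<in> cocycles X n" "z \<ominus>\<^bsub>obj Y n\<^esub> f n x \<in> coboundaries Y n"
    by (rule quasi_iso_surj[OF X Y f z])
  have fx: "f n x \<in> adic_coboundaries A I Y n"
    using chain_map_adic_coboundaries[OF X Y cf] x(1) sub by blast
  have "(z \<ominus>\<^bsub>obj Y n\<^esub> f n x) \<oplus>\<^bsub>obj Y n\<^esub> f n x \<in> adic_coboundaries A I Y n"
    using submodule_add[OF adic_coboundaries_submodule[OF Y] adic_coboundariesI(1)[OF x(2)] fx] .
  moreover have "z \<in> carrier (obj Y n)" "f n x \<in> carrier (obj Y n)"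
    using z submodule_subset[OF adic_coboundaries_submodule[OF Y] fx] by (auto simp: cocycles_def)
  ultimately show "z \<in> adic_coboundaries A I Y n" by (simp add: Y.minus_eq Y.a_assoc Y.l_neg)
qed

text \<open>The map need not be invertible on cochains, so B^n + I Z^n of \<open>Y\<close> is first
  covered by the sum of B^n of \<open>Y\<close> and the image of B^n + I Z^n of \<open>X\<close>: if
  z is cohomologous to f x, then a z = a (z - f x) + f (a x). With f z = b + f w, the cocycle z - w
  goes to the coboundary b and so is a coboundary itself.\<close>

lemma quasi_iso_adic_coboundaries_backward:
  assumes X: "is_complex A X" and Y: "is_complex A Y" and f: "quasi_iso A X Y f"
    and sub: "cocycles Y n \<subseteq> adic_coboundaries A I Y n"
  shows "cocycles X n \<subseteq> adic_coboundaries A I X n"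
proof
  note MX = complex_module[OF X, of n] and MY = complex_module[OF Y, of n]
  interpret X: module A "obj X n" by (rule MX)
  interpret Y: module A "obj Y n" by (rule MY)
  have cf: "chain_map A X Y f" using f by (simp add: quasi_iso_def)
  note fl = chain_map_linear[OF cf, of n] and WX = adic_coboundaries_submodule[OF X, of n]
  note BY = coboundaries_submodule[OF Y, of n] and ZX = cocycles_submodule[OF X, of n]
  let ?S = "{b \<oplus>\<^bsub>obj Y n\<^esub> y | b y. b \<in> coboundaries Y n \<and> y \<in> f n ` adic_coboundaries A I X n}"
  have W: "submodule (f n ` adic_coboundaries A I X n) A (obj Y n)" by (rule submodule_image[OF MX MY fl WX])
  have "b \<in> ?S" if "b \<in> coboundaries Y n" for b
    using that submodule_zero[OF W] submodule_subset[OF BY that] Y.r_zero by force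
  moreover have "a \<odot>\<^bsub>obj Y n\<^esub> z \<in> ?S" if a: "a \<in> I" and z: "z \<in> cocycles Y n" for a z
  proof -
    obtain x where x: "x \<in> cocycles X n" "z \<ominus>\<^bsub>obj Y n\<^esub> f n x \<in> coboundaries Y n"
      by (rule quasi_iso_surj[OF X Y f z])
    have ac: "a \<in> carrier A" using a ideal.Icarr[OF I] by blast
    have xc: "x \<in> carrier (obj X n)" and zc: "z \<in> carrier (obj Y n)" and fc: "f n x \<in> carrier (obj Y n)"
      using x z linear_maps_closed[OF fl] by (auto simp: cocycles_def)
    have "z = (z \<ominus>\<^bsub>obj Y n\<^esub> f n x) \<oplus>\<^bsub>obj Y n\<^esub> f n x"
      using zc fc by (simp add: Y.minus_eq Y.a_assoc Y.l_neg)
    then have "a \<odot>\<^bsub>obj Y n\<^esub> z = a \<odot>\<^bsub>obj Y n\<^esub> (z \<ominus>\<^bsub>obj Y n\<^esub> f n x) \<oplus>\<^bsub>obj Y n\<^esub> f n (a \<odot>\<^bsub>obj X n\<^esub> x)"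
      using Y.smult_r_distr[OF ac Y.minus_closed[OF zc fc] fc] linear_maps_smult[OF fl ac xc] by simp
    then show ?thesis
      using submodule_smult[OF BY ac x(2)] adic_coboundariesI(2)[OF a x(1)] by blast
  qed
  ultimately have S: "adic_coboundaries A I Y n \<subseteq> ?S"
    unfolding adic_coboundaries_def[of A I Y]
    by (intro submodule_span_least submodule_sum[OF MY BY W]) blast
  fix z assume z: "z \<in> cocycles X n"
  then have "f n z \<in> ?S" using chain_map_cocycles[OF X Y cf z] sub S by blast
  then obtain b w where bw: "b \<in> coboundaries Y n" "w \<in> adic_coboundaries A I X n"
    "f n z = b \<oplus>\<^bsub>obj Y n\<^esub> f n w" by blast
  have wZ: "w \<in> cocycles X n" using bw(2) adic_coboundaries_subset_cocycles[OF X] by blast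
  have c: "z \<in> carrier (obj X n)" "w \<in> carrier (obj X n)" "b \<in> carrier (obj Y n)" "f n w \<in> carrier (obj Y n)"
    using z wZ submodule_subset[OF ZX] submodule_subset[OF BY bw(1)] linear_maps_closed[OF fl] by auto
  have "f n (z \<ominus>\<^bsub>obj X n\<^esub> w) = b"
    using c bw(3) by (simp add: linear_maps_diff[OF MX MY fl] Y.minus_eq Y.a_assoc Y.r_neg)
  then have "z \<ominus>\<^bsub>obj X n\<^esub> w \<in> coboundaries X n"
    using quasi_iso_inj[OF X Y f submodule_diff[OF ZX z wZ]] bw(1) by simp
  then have "(z \<ominus>\<^bsub>obj X n\<^esub> w) \<oplus>\<^bsub>obj X n\<^esub> w \<in> adic_coboundaries A I X n"
    by (intro submodule_add[OF WX] adic_coboundariesI(1) bw(2))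
  then show "z \<in> adic_coboundaries A I X n" using c by (simp add: X.minus_eq X.a_assoc X.l_neg)
qed

section \<open>Reduction modulo the ideal\<close>

lemma ideal_submodule_regular: "submodule I A (regular_module A)"
proof -
  interpret cring A by (rule A)
  interpret ideal I A by (rule I)
  show ?thesis
    by (rule submoduleI'[OF regular_module_module[OF A]])
      (auto simp: regular_module_def I_l_closed intro: a_subset[THEN subsetD])
qed

text \<open>As \<open>I\<close> kills the image of \<open>g\<close>, the rule (a + I) \<otimes> x
  \<mapsto> a g(x) is well defined and bilinear. The map \<open>l\<close> is this rule on the free
  module that covers the tensor product.\<close>

lemma tensor_relations_kernel:
  assumes P: "module A P" and G: "module A G" and g: "g \<in> linear_maps A P G"
    and ann: "\<And>a x. a \<in> I \<Longrightarrow> x \<in> carrier P \<Longrightarrow> a \<odot>\<^bsub>G\<^esub> g x = \<zero>\<^bsub>G\<^esub>"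
  obtains l where "l \<in> linear_maps A (tensor_free A (quot_module (regular_module A) I) P) G"
    "\<And>\<phi>. \<phi> \<in> tensor_relations A (quot_module (regular_module A) I) P \<Longrightarrow> l \<phi> = \<zero>\<^bsub>G\<^esub>"
    "\<And>a x. a \<in> carrier A \<Longrightarrow> x \<in> carrier P
      \<Longrightarrow> l (free_basis A (I +>\<^bsub>regular_module A\<^esub> a, x)) = a \<odot>\<^bsub>G\<^esub> g x"
proof -
  note RM = regular_module_module[OF A] and IM = ideal_submodule_regular
  let ?A0 = "quot_module (regular_module A) I"
  interpret R: module A "regular_module A" by (rule RM)
  interpret P: module A P by fact
  interpret G: module A G by fact
  have reg: "carrier (regular_module A) = carrier A" "(\<oplus>\<^bsub>regular_module A\<^esub>) = (\<oplus>\<^bsub>A\<^esub>)"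
    "smult (regular_module A) = (\<otimes>\<^bsub>A\<^esub>)" by (simp_all add: regular_module_def)
  \<comment> \<open>By \<open>ann\<close> the value does not depend on the representative of the
    coset, so an arbitrary choice is harmless.\<close>
  define \<beta> where "\<beta> = (\<lambda>X x. (SOME a. a \<in> X) \<odot>\<^bsub>G\<^esub> g x)"
  note gc = linear_maps_closed[OF g]
  have \<beta>: "\<beta> (I +>\<^bsub>regular_module A\<^esub> a) x = a \<odot>\<^bsub>G\<^esub> g x" if a: "a \<in> carrier A" and x: "x \<in> carrier P" for a x
  proof -
    have ar: "a \<in> carrier (regular_module A)" using a by (simp add: reg)
    let ?b = "SOME b. b \<in> I +>\<^bsub>regular_module A\<^esub> a"
    have "?b \<in> I +>\<^bsub>regular_module A\<^esub> a" using coset_self[OF RM IM ar] by (rule someI)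
    then obtain i where i: "i \<in> I" "?b = i \<oplus>\<^bsub>A\<^esub> a" by (auto simp: a_r_coset_def' reg)
    have ic: "i \<in> carrier A" using ideal.Icarr[OF I i(1)] .
    show ?thesis
      unfolding \<beta>_def i(2) using ann[OF i(1) x] ic a gc[OF x] by (simp add: G.smult_l_distr)
  qed
  have A0E: thesis if "X \<in> carrier ?A0" "\<And>a. a \<in> carrier A \<Longrightarrow> X = I +>\<^bsub>regular_module A\<^esub> a \<Longrightarrow> thesis" for X thesis
    using that unfolding carrier_quot_module[OF RM IM] reg by blast
  have add: "(I +>\<^bsub>regular_module A\<^esub> a) \<oplus>\<^bsub>?A0\<^esub> (I +>\<^bsub>regular_module A\<^esub> b) = I +>\<^bsub>regular_module A\<^esub> (a \<oplus>\<^bsub>A\<^esub> b)"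
    if "a \<in> carrier A" "b \<in> carrier A" for a b
    using add_quot_module[OF RM IM, of a b] that by (simp add: reg)
  have smult: "a \<odot>\<^bsub>?A0\<^esub> (I +>\<^bsub>regular_module A\<^esub> b) = I +>\<^bsub>regular_module A\<^esub> (a \<otimes>\<^bsub>A\<^esub> b)"
    if "a \<in> carrier A" "b \<in> carrier A" for a b
    using smult_quot_module[OF RM IM, of a b] that by (simp add: reg)
  have closed: "\<beta> X x \<in> carrier G" if "X \<in> carrier ?A0" "x \<in> carrier P" for X x
    using that(1) by (rule A0E) (simp add: \<beta> that(2) gc)
  have \<beta>c: "case_prod \<beta> \<in> carrier ?A0 \<times> carrier P \<rightarrow> carrier G" using closed by auto
  show thesis
  proof
    show "free_lift A G (case_prod \<beta>) \<in> linear_maps A (tensor_free A ?A0 P) G"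
      unfolding tensor_free_def by (rule free_lift_linear[OF G \<beta>c])
    show "free_lift A G (case_prod \<beta>) (free_basis A (I +>\<^bsub>regular_module A\<^esub> a, x)) = a \<odot>\<^bsub>G\<^esub> g x"
      if "a \<in> carrier A" "x \<in> carrier P" for a x
      using that coset_in_quot_module[OF RM IM, of a]
      by (subst free_lift_basis[OF G \<beta>c]) (simp_all add: \<beta> reg)
    show "free_lift A G (case_prod \<beta>) \<phi> = \<zero>\<^bsub>G\<^esub>" if "\<phi> \<in> tensor_relations A ?A0 P" for \<phi>
    proof (rule bilinear_lift_tensor_relations[OF quot_module_module[OF RM IM] P G closed _ _ _ _ that])
      fix X x assume "X \<in> carrier ?A0" and x: "x \<in> carrier P"
      then obtain b where b: "b \<in> carrier A" "X = I +>\<^bsub>regular_module A\<^esub> b" by (blast elim: A0E)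
      show "\<beta> X (x \<oplus>\<^bsub>P\<^esub> y) = \<beta> X x \<oplus>\<^bsub>G\<^esub> \<beta> X y" if "y \<in> carrier P" for y
        using that b x gc by (simp add: \<beta> linear_maps_add[OF g] G.smult_r_distr)
      show "\<beta> (X \<oplus>\<^bsub>?A0\<^esub> Y) x = \<beta> X x \<oplus>\<^bsub>G\<^esub> \<beta> Y x" if "Y \<in> carrier ?A0" for Y
        using that by (rule A0E) (use b x gc in \<open>simp add: \<beta> add G.smult_l_distr\<close>)
      fix a assume a: "a \<in> carrier A"
      show "\<beta> (a \<odot>\<^bsub>?A0\<^esub> X) x = a \<odot>\<^bsub>G\<^esub> \<beta> X x"
        using a b x gc by (simp add: \<beta> smult G.smult_assoc1)
      show "\<beta> X (a \<odot>\<^bsub>P\<^esub> x) = a \<odot>\<^bsub>G\<^esub> \<beta> X x"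
        using a b x G.smult_assoc1[OF a b(1) gc[OF x]] G.smult_assoc1[OF b(1) a gc[OF x]] R.R.m_comm[OF a b(1)]
        by (simp add: \<beta> linear_maps_smult[OF g])
    qed
  qed
qed

text \<open>The target \<open>?G\<close> is Q^n / (B^n + I Z^n), which contains H^n / I H^n as a
  submodule; this avoids quotients of cohomology modules. The cocycle 1 \<otimes> z is a coboundary,
  \<open>l\<close> vanishes on coboundaries, and \<open>l\<close> sends 1 \<otimes> z to the class
  of z.\<close>

lemma cocycles_subset_adic_coboundaries:
  fixes Q :: "('a, 'm) cochain_complex"
  defines "A0 \<equiv> quot_module (regular_module A) I"
  assumes Q: "K_projective A Q" and top: "\<And>i. i > n \<Longrightarrow> cocycles Q i \<subseteq> coboundaries Q i"
    and acyclic: "cocycles (tensor_complex A A0 Q) n \<subseteq> coboundaries (tensor_complex A A0 Q) n"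
  shows "cocycles Q n \<subseteq> adic_coboundaries A I Q n"
proof
  interpret A: cring A by (rule A)
  have cQ: "is_complex A Q" using Q by (simp add: K_projective_def)
  note M = complex_module[OF cQ] and B = coboundaries_submodule[OF cQ, of n]
    and W = adic_coboundaries_submodule[OF cQ, of n] and d = complex_diff[OF cQ]
    and dp = complex_diff_pred[OF cQ, of n]
  note Zc = submodule_subset[OF cocycles_submodule[OF cQ, of n]]
  let ?G = "quot_module (obj Q n) (adic_coboundaries A I Q n)"
  note G = quot_module_module[OF M W]
  interpret G: module A ?G by (rule G)
  interpret M: module A "obj Q n" by (rule M)
  obtain g where g: "g \<in> linear_maps A (obj Q n) (quot_module (obj Q n) (coboundaries Q n))"
    and gim: "\<And>x. x \<in> carrier (obj Q n) \<Longrightarrow> g x \<in> (\<lambda>z. coboundaries Q n +>\<^bsub>obj Q n\<^esub> z) ` cocycles Q n"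
    and gB: "\<And>b. b \<in> coboundaries Q n \<Longrightarrow> g b = coboundaries Q n"
    and gZ: "\<And>z. z \<in> cocycles Q n \<Longrightarrow> g z = coboundaries Q n +>\<^bsub>obj Q n\<^esub> z"
    using K_projective_top_cohomology[OF Q top] by blast
  define p where "p = quot_map (obj Q n) (adic_coboundaries A I Q n) id"
  have BW: "id b \<in> adic_coboundaries A I Q n" if "b \<in> coboundaries Q n" for b
    using adic_coboundariesI(1)[OF that] by simp
  have p: "p \<in> linear_maps A (quot_module (obj Q n) (coboundaries Q n)) ?G"
    unfolding p_def by (rule quot_map_linear[OF M B M W linear_maps_id BW])
  have pz: "p (coboundaries Q n +>\<^bsub>obj Q n\<^esub> z) = adic_coboundaries A I Q n +>\<^bsub>obj Q n\<^esub> z"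
    if "z \<in> carrier (obj Q n)" for z
    using quot_map_coset[where f = id, OF M B M W linear_maps_id BW that] by (simp add: p_def)
  define \<gamma> where "\<gamma> = (\<lambda>x. p (g x))"
  have \<gamma>: "\<gamma> \<in> linear_maps A (obj Q n) ?G" unfolding \<gamma>_def by (rule linear_maps_comp[OF g p])
  have zG: "\<zero>\<^bsub>?G\<^esub> = adic_coboundaries A I Q n" by (rule zero_quot_module[OF M W])
  note Wiff = coset_eq_submodule_iff[OF M W]
  have \<gamma>B: "\<gamma> b = \<zero>\<^bsub>?G\<^esub>" if "b \<in> coboundaries Q n" for b
    using gB[OF that] pz[OF M.zero_closed] by (simp add: \<gamma>_def zG coset_zero[OF M B] coset_zero[OF M W])
  have \<gamma>Z: "\<gamma> z = adic_coboundaries A I Q n +>\<^bsub>obj Q n\<^esub> z" if "z \<in> cocycles Q n" for z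
    using gZ[OF that] pz[OF Zc[OF that]] by (simp add: \<gamma>_def)
  \<comment> \<open>The ideal need not kill all of \<open>?G\<close>. It kills the values of
    \<open>\<gamma>\<close> because \<open>g\<close> takes values in classes of cocycles, and a
    multiple of a cocycle by an element of \<open>I\<close> lies in I Z^n.\<close>
  have ann: "a \<odot>\<^bsub>?G\<^esub> \<gamma> x = \<zero>\<^bsub>?G\<^esub>" if a: "a \<in> I" and x: "x \<in> carrier (obj Q n)" for a x
  proof -
    obtain y where y: "y \<in> cocycles Q n" "g x = coboundaries Q n +>\<^bsub>obj Q n\<^esub> y"
      using gim[OF x] by blast
    have ac: "a \<in> carrier A" using ideal.Icarr[OF I a] .
    have "a \<odot>\<^bsub>?G\<^esub> \<gamma> x = adic_coboundaries A I Q n +>\<^bsub>obj Q n\<^esub> (a \<odot>\<^bsub>obj Q n\<^esub> y)"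
      using smult_quot_module[OF M W ac Zc[OF y(1)]] pz[OF Zc[OF y(1)]] y(2) by (simp add: \<gamma>_def)
    then show ?thesis using Wiff adic_coboundariesI(2)[OF a y(1)] ac Zc[OF y(1)] by (simp add: zG)
  qed
  have A0: "module A A0"
    unfolding A0_def by (rule quot_module_module[OF regular_module_module[OF A] ideal_submodule_regular])
  note F = tensor_free_module[OF A] and R = tensor_relations_submodule[OF A0 M]
  obtain l where l: "l \<in> linear_maps A (tensor_free A A0 (obj Q n)) ?G"
    and lR: "\<And>\<phi>. \<phi> \<in> tensor_relations A A0 (obj Q n) \<Longrightarrow> l \<phi> = \<zero>\<^bsub>?G\<^esub>"
    and lb: "\<And>a x. a \<in> carrier A \<Longrightarrow> x \<in> carrier (obj Q n)
      \<Longrightarrow> l (free_basis A (I +>\<^bsub>regular_module A\<^esub> a, x)) = a \<odot>\<^bsub>?G\<^esub> \<gamma> x"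
    using tensor_relations_kernel[OF M G \<gamma> ann] unfolding A0_def by blast
  let ?f = "\<lambda>i. free_map A (\<lambda>(t, x). (t, diff Q i x))"
  note f = tensor_free_map_linear[OF A d, where T = A0] and fp = tensor_free_map_linear[OF A dp, of A0]
  \<comment> \<open>On a basis element (a + I, x) the result is a times the value of
    \<open>\<gamma>\<close> on the coboundary of x, which is zero.\<close>
  have lf: "l (?f (n - 1) \<phi>) = \<zero>\<^bsub>?G\<^esub>" if \<phi>: "\<phi> \<in> carrier (tensor_free A A0 (obj Q (n - 1)))" for \<phi>
  proof -
    have "l (?f (n - 1) (free_basis A (X, x))) = \<zero>\<^bsub>?G\<^esub>" if X: "X \<in> carrier A0" and x: "x \<in> carrier (obj Q (n - 1))" for X x
    proof -
      obtain a where a: "a \<in> carrier A" "X = I +>\<^bsub>regular_module A\<^esub> a"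
        using X unfolding A0_def carrier_quot_module[OF regular_module_module[OF A] ideal_submodule_regular]
        by (auto simp: regular_module_def)
      moreover have "diff Q (n - 1) x \<in> coboundaries Q n" using x by (simp add: coboundaries_def)
      ultimately show ?thesis
        using lb[OF a(1) submodule_subset[OF B]] \<gamma>B by (simp add: free_map_basis[OF A])
    qed
    then have "carrier (tensor_free A A0 (obj Q (n - 1)))
        \<subseteq> {\<phi> \<in> carrier (tensor_free A A0 (obj Q (n - 1))). l (?f (n - 1) \<phi>) = \<zero>\<^bsub>?G\<^esub>}"
      using submodule_kernel[OF F G linear_maps_comp[OF fp l]] free_basis_closed[OF A SigmaI]
      unfolding tensor_free_def by (intro free_module_subset[OF A]) auto
    with \<phi> show ?thesis by blast
  qed
  fix z assume z: "z \<in> cocycles Q n"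
  \<comment> \<open>The basis element \<open>?e\<close> at (1 + I, z) represents 1 \<otimes> z, a
    cocycle since its differential is 1 \<otimes> 0.\<close>
  let ?one = "I +>\<^bsub>regular_module A\<^esub> \<one>\<^bsub>A\<^esub>"
  have one: "?one \<in> carrier A0"
    unfolding A0_def by (rule coset_in_quot_module[OF regular_module_module[OF A] ideal_submodule_regular])
      (simp add: regular_module_def)
  let ?e = "free_basis A (?one, z)"
  have e: "?e \<in> carrier (tensor_free A A0 (obj Q n))" by (rule tensor_basis_closed[OF A one Zc[OF z]])
  let ?w = "tensor_relations A A0 (obj Q n) +>\<^bsub>tensor_free A A0 (obj Q n)\<^esub> ?e"
  have "?f n ?e = free_basis A (?one, \<zero>\<^bsub>obj Q (n + 1)\<^esub>)"
    using z by (simp add: free_map_basis[OF A] cocycles_def)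
  then have "?f n ?e \<in> tensor_relations A A0 (obj Q (n + 1))"
    using tensor_basis_zero[OF A0 M one] by simp
  then have "?w \<in> cocycles (tensor_complex A A0 Q) n"
    using coset_eq_submodule_iff[OF F R linear_maps_closed[OF f e]] coset_in_quot_module[OF F R e]
    by (simp add: cocycles_def tensor_complex_def tensor_map_coset[OF A0 M M d e] tensor_module_def
        zero_quot_module[OF F R])
  then have "?w \<in> coboundaries (tensor_complex A A0 Q) n" using acyclic by blast
  then obtain v where v: "v \<in> carrier (tensor_module A A0 (obj Q (n - 1)))"
    "?w = tensor_map A A0 (obj Q n) (diff Q (n - 1)) v"
    by (auto simp: coboundaries_def tensor_complex_def)
  then obtain \<phi> where \<phi>: "\<phi> \<in> carrier (tensor_free A A0 (obj Q (n - 1)))"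
    "v = tensor_relations A A0 (obj Q (n - 1)) +>\<^bsub>tensor_free A A0 (obj Q (n - 1))\<^esub> \<phi>"
    by (auto simp: tensor_module_def carrier_quot_module[OF F R])
  have f\<phi>: "?f (n - 1) \<phi> \<in> carrier (tensor_free A A0 (obj Q n))" by (rule linear_maps_closed[OF fp \<phi>(1)])
  have "?e \<ominus>\<^bsub>tensor_free A A0 (obj Q n)\<^esub> ?f (n - 1) \<phi> \<in> tensor_relations A A0 (obj Q n)"
    using v(2) coset_eq_iff[OF F R e f\<phi>] unfolding \<phi>(2) tensor_map_coset[OF A0 M M dp \<phi>(1)] by blast
  then have "l ?e \<ominus>\<^bsub>?G\<^esub> l (?f (n - 1) \<phi>) = \<zero>\<^bsub>?G\<^esub>"
    using lR linear_maps_diff[OF F G l e f\<phi>] by simp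
  moreover have "l ?e = \<gamma> z"
    using lb[OF A.one_closed Zc[OF z]] linear_maps_closed[OF \<gamma> Zc[OF z]] by simp
  moreover have "\<gamma> z \<ominus>\<^bsub>?G\<^esub> \<zero>\<^bsub>?G\<^esub> = \<gamma> z"
    using linear_maps_closed[OF \<gamma> Zc[OF z]] G.minus_equality[OF G.l_zero[OF G.zero_closed]]
    by (simp add: G.minus_eq)
  ultimately have "\<gamma> z = \<zero>\<^bsub>?G\<^esub>" using lf[OF \<phi>(1)] by simp
  then show "z \<in> adic_coboundaries A I Q n"
    using \<gamma>Z[OF z] Wiff[OF Zc[OF z]] zG by simp
qed

text \<open>
  Iterating \<open>Z \<subseteq> B + I Z\<close> writes a cocycle as the image of a series in \<open>X\<^bsup>n - 1\<^esup>\<close> whose terms lie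
  in higher and higher powers of \<open>I\<close>; the series converges in the completion.
\<close>

lemma completion_unit_coboundary:
  assumes X: "is_complex A X" and sub: "cocycles X n \<subseteq> adic_coboundaries A I X n"
    and z: "z \<in> cocycles X n"
  shows "completion_unit A I (obj X n) z \<in> coboundaries (completion_complex A I X) n"
proof -
  note M = complex_module[OF X, of n] and M' = complex_module[OF X, of "n - 1"]
    and dp = complex_diff_pred[OF X, of n]
  note B = coboundaries_submodule[OF X, of n] and Z = cocycles_submodule[OF X, of n]
  note Zc = submodule_subset[OF Z]
  interpret M: module A "obj X n" by (rule M)
  interpret M': module A "obj X (n - 1)" by (rule M')
  let ?d = "diff X (n - 1)"
  let ?gen = "\<lambda>J. {a \<odot>\<^bsub>obj X n\<^esub> z | a z. a \<in> J \<and> z \<in> cocycles X n}"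
  \<comment> \<open>This is I^k Z^n. Multiples of cocycles, and not of arbitrary cochains, are
    needed because the hypothesis \<open>sub\<close> can be applied only to cocycles.\<close>
  define C where "C = (\<lambda>k. submodule_span A (obj X n) (?gen (ideal_power A I k)))"
  have genc: "?gen J \<subseteq> carrier (obj X n)" if "J \<subseteq> carrier A" for J
    using that Zc M.smult_closed by blast
  have Ic: "I \<subseteq> carrier A" and Pc: "ideal_power A I k \<subseteq> carrier A" for k
    using ideal.Icarr[OF I] ideal_power_closed[OF A I] by blast+
  have C: "submodule (C k) A (obj X n)" for k
    unfolding C_def by (rule submodule_span_submodule[OF M genc[OF Pc]])
  have Cadic: "C k \<subseteq> adic_submodule A I (obj X n) k" for k
    unfolding C_def adic_submodule_def by (rule submodule_span_mono) (use Zc in blast)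
  have IZ: "submodule (submodule_span A (obj X n) (?gen I)) A (obj X n)"
    by (rule submodule_span_submodule[OF M genc[OF Ic]])
  have W: "adic_coboundaries A I X n
      \<subseteq> {b \<oplus>\<^bsub>obj X n\<^esub> w | b w. b \<in> coboundaries X n \<and> w \<in> submodule_span A (obj X n) (?gen I)}" (is "_ \<subseteq> ?S")
    unfolding adic_coboundaries_def
  proof (rule submodule_span_least[OF submodule_sum[OF M B IZ]], rule Un_least)
    show "coboundaries X n \<subseteq> ?S"
      using submodule_zero[OF IZ] submodule_subset[OF B] M.r_zero by force
    show "?gen I \<subseteq> ?S"
      using submodule_zero[OF B] submodule_subset[OF IZ] M.l_zero submodule_span_superset[of _ "?gen I" A "obj X n"]
      by force
  qed
  \<comment> \<open>I^k (I Z^n) lies in I^(k+1) Z^n. The factors are swapped because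
    \<open>ideal_power\<close> puts the new factor on the left.\<close>
  have IC: "a \<odot>\<^bsub>obj X n\<^esub> w \<in> C (Suc k)"
    if a: "a \<in> ideal_power A I k" and w: "w \<in> submodule_span A (obj X n) (?gen I)" for a w k
  proof -
    have ac: "a \<in> carrier A" using a Pc by blast
    have "?gen I \<subseteq> {w \<in> carrier (obj X n). a \<odot>\<^bsub>obj X n\<^esub> w \<in> C (Suc k)}"
    proof
      fix u assume "u \<in> ?gen I"
      then obtain b y where bz: "b \<in> I" "y \<in> cocycles X n" "u = b \<odot>\<^bsub>obj X n\<^esub> y" by blast
      have bc: "b \<in> carrier A" using bz(1) Ic by blast
      have "a \<odot>\<^bsub>obj X n\<^esub> u = (b \<otimes>\<^bsub>A\<^esub> a) \<odot>\<^bsub>obj X n\<^esub> y"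
        using M.smult_assoc1[OF ac bc Zc[OF bz(2)]] M.R.m_comm[OF ac bc] bz(3) by simp
      moreover have "b \<otimes>\<^bsub>A\<^esub> a \<in> ideal_power A I (Suc k)" using ideal_prod.prod[OF bz(1) a] by simp
      ultimately have "a \<odot>\<^bsub>obj X n\<^esub> u \<in> C (Suc k)"
        unfolding C_def using bz(2) by (intro submodule_span_superset) blast
      then show "u \<in> {w \<in> carrier (obj X n). a \<odot>\<^bsub>obj X n\<^esub> w \<in> C (Suc k)}"
        using bz(3) bc Zc[OF bz(2)] by simp
    qed
    from submodule_span_least[OF submodule_vimage[OF M M smult_linear[OF M ac] C] this] w
    show ?thesis by blast
  qed
  \<comment> \<open>Multiplying Z^n = B^n + I Z^n by I^k shows that I^k Z^n lies in d(I^k X^(n-1)) +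
    I^(k+1) Z^n: a scalar a in I^k moves inside d and makes the cochain small.\<close>
  have step: "\<exists>x\<in>adic_submodule A I (obj X (n - 1)) k. \<exists>y'\<in>C (Suc k). y = ?d x \<oplus>\<^bsub>obj X n\<^esub> y'"
    if y: "y \<in> C k" for k y
  proof -
    note K = adic_submodule_submodule[OF I M', of k]
    let ?T = "{u \<oplus>\<^bsub>obj X n\<^esub> v | u v. u \<in> ?d ` adic_submodule A I (obj X (n - 1)) k \<and> v \<in> C (Suc k)}"
    have "?gen (ideal_power A I k) \<subseteq> ?T"
    proof
      fix u assume "u \<in> ?gen (ideal_power A I k)"
      then obtain a z where a: "a \<in> ideal_power A I k" and z: "z \<in> cocycles X n" and u: "u = a \<odot>\<^bsub>obj X n\<^esub> z"
        by blast
      have ac: "a \<in> carrier A" using a Pc by blast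
      have "z \<in> ?S" using z sub W by blast
      then obtain b w where bw: "z = b \<oplus>\<^bsub>obj X n\<^esub> w" "b \<in> coboundaries X n"
        "w \<in> submodule_span A (obj X n) (?gen I)" by blast
      then obtain x where x: "x \<in> carrier (obj X (n - 1))" "b = ?d x" by (auto simp: coboundaries_def)
      have "u = ?d (a \<odot>\<^bsub>obj X (n - 1)\<^esub> x) \<oplus>\<^bsub>obj X n\<^esub> a \<odot>\<^bsub>obj X n\<^esub> w"
        unfolding u bw(1) x(2) linear_maps_smult[OF dp ac x(1)]
        by (rule M.smult_r_distr[OF ac linear_maps_closed[OF dp x(1)] submodule_subset[OF IZ bw(3)]])
      moreover have "a \<odot>\<^bsub>obj X (n - 1)\<^esub> x \<in> adic_submodule A I (obj X (n - 1)) k"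
        unfolding adic_submodule_def using a x(1) by (intro submodule_span_superset) blast
      ultimately show "u \<in> ?T" using IC[OF a bw(3)] by blast
    qed
    with y submodule_span_least[OF submodule_sum[OF M submodule_image[OF M' M dp K] C] this]
    have "y \<in> ?T" unfolding C_def by blast
    then show ?thesis by blast
  qed
  then have "\<forall>k y. \<exists>x y'. y \<in> C k \<longrightarrow> x \<in> adic_submodule A I (obj X (n - 1)) k \<and> y' \<in> C (Suc k)
      \<and> y = ?d x \<oplus>\<^bsub>obj X n\<^esub> y'" by blast
  then obtain \<xi> \<zeta> where \<xi>: "\<And>k y. y \<in> C k \<Longrightarrow> \<xi> k y \<in> adic_submodule A I (obj X (n - 1)) k"
    and \<zeta>: "\<And>k y. y \<in> C k \<Longrightarrow> \<zeta> k y \<in> C (Suc k)"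
    and eq: "\<And>k y. y \<in> C k \<Longrightarrow> y = ?d (\<xi> k y) \<oplus>\<^bsub>obj X n\<^esub> \<zeta> k y"
    unfolding choice_iff by blast
  \<comment> \<open>After k steps \<open>r k\<close> is the remainder and \<open>s k\<close> the
    partial sum, with z = \<open>r k\<close> + d(\<open>s k\<close>) throughout.\<close>
  define r where "r = rec_nat z \<zeta>"
  define s where "s = rec_nat \<zero>\<^bsub>obj X (n - 1)\<^esub> (\<lambda>k s. \<xi> k (r k) \<oplus>\<^bsub>obj X (n - 1)\<^esub> s)"
  have r_simps: "r 0 = z" "r (Suc k) = \<zeta> k (r k)" for k by (simp_all add: r_def)
  have s_simps: "s 0 = \<zero>\<^bsub>obj X (n - 1)\<^esub>" "s (Suc k) = \<xi> k (r k) \<oplus>\<^bsub>obj X (n - 1)\<^esub> s k" for k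
    by (simp_all add: s_def)
  have "z \<in> C 0"
  proof -
    have "\<one>\<^bsub>A\<^esub> \<odot>\<^bsub>obj X n\<^esub> z \<in> C 0"
      unfolding C_def using z M.R.one_closed by (intro submodule_span_superset) auto
    then show ?thesis using Zc[OF z] by simp
  qed
  then have r: "r k \<in> C k" for k by (induction k) (simp_all add: r_simps \<zeta>)
  have \<xi>c: "\<xi> k (r k) \<in> carrier (obj X (n - 1))" for k
    using submodule_subset[OF adic_submodule_submodule[OF I M'] \<xi>[OF r]] .
  have s: "s k \<in> carrier (obj X (n - 1))" for k by (induction k) (simp_all add: s_simps \<xi>c)
  have rc: "r k \<in> carrier (obj X n)" for k using submodule_subset[OF C r] .
  have dc: "?d x \<in> carrier (obj X n)" if "x \<in> carrier (obj X (n - 1))" for x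
    using linear_maps_closed[OF dp that] .
  have sum: "z = r k \<oplus>\<^bsub>obj X n\<^esub> ?d (s k)" for k
  proof (induction k)
    case 0
    show ?case using linear_maps_zero[OF M' M dp] Zc[OF z] by (simp add: s_simps r_simps)
  next
    case (Suc k)
    note Suc
    also have "r k \<oplus>\<^bsub>obj X n\<^esub> ?d (s k) = (?d (\<xi> k (r k)) \<oplus>\<^bsub>obj X n\<^esub> r (Suc k)) \<oplus>\<^bsub>obj X n\<^esub> ?d (s k)"
      using eq[OF r[of k]] by (simp add: r_simps)
    also have "\<dots> = r (Suc k) \<oplus>\<^bsub>obj X n\<^esub> ?d (s (Suc k))"
      by (simp add: s_simps(2) linear_maps_add[OF dp \<xi>c s] M.a_ac dc s \<xi>c rc)
    finally show ?case .
  qed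
  let ?\<sigma> = "\<lambda>k. adic_submodule A I (obj X (n - 1)) k +>\<^bsub>obj X (n - 1)\<^esub> s k"
  \<comment> \<open>The k-th term lies in I^k X^(n-1), so the partial sums are Cauchy in the sense
    of \<open>completion_mapI\<close>.\<close>
  have "s (Suc k) \<ominus>\<^bsub>obj X (n - 1)\<^esub> s k = \<xi> k (r k)" for k
    using s[of k] \<xi>c[of k] by (simp add: s_simps(2) M'.minus_eq M'.a_assoc M'.r_neg)
  then have \<sigma>: "?\<sigma> \<in> carrier (completion A I (obj X (n - 1)))"
    using \<xi>[OF r] s by (intro completion_mapI[OF A I M']) simp_all
  have "completion_map A I (obj X n) ?d ?\<sigma> k = completion_unit A I (obj X n) z k" for k
  proof -
    have "completion_map A I (obj X n) ?d ?\<sigma> k = adic_submodule A I (obj X n) k +>\<^bsub>obj X n\<^esub> ?d (s k)"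
      by (rule completion_map_coset[OF A I M' M dp refl s])
    \<comment> \<open>At level k the error is \<open>r k\<close>, an element of I^k Z^n and thus of
      I^k X^n.\<close>
    also have "\<dots> = adic_submodule A I (obj X n) k +>\<^bsub>obj X n\<^esub> z"
    proof (rule coset_eqI[OF M adic_submodule_submodule[OF I M] Zc[OF z] dc[OF s], symmetric])
      have "z \<ominus>\<^bsub>obj X n\<^esub> ?d (s k) = r k"
        using dc[OF s[of k]] rc[of k] by (subst sum[of k]) (simp add: M.minus_eq M.a_assoc M.r_neg)
      then show "z \<ominus>\<^bsub>obj X n\<^esub> ?d (s k) \<in> adic_submodule A I (obj X n) k" using r Cadic by auto
    qed
    finally show ?thesis by (simp add: completion_unit_def)
  qed
  then have "completion_unit A I (obj X n) z = completion_map A I (obj X n) ?d ?\<sigma>" by auto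
  then show ?thesis using \<sigma> by (auto simp: coboundaries_def completion_complex_def)
qed

end

theorem corollary0p3:
  fixes A :: "('a, 'r) ring_scheme"
    and I :: "'a set"
    and M :: "('a, 'm) cochain_complex"
  assumes "cring A"
    and "noetherian_ring A"
    and "ideal I A"
    and "adically_complete A I (regular_module A)"
    and "M \<in> D_minus_com A I"
    and "\<exists>N \<in> derived_tensor A (quot_module (regular_module A) I) M. derived_zero A N"
  shows "derived_zero A M"
proof -
  note A = assms(1) and I = assms(3)
  let ?A0 = "quot_module (regular_module A) I"
  have M: "is_complex A M" and bounded: "cohomology_bounded_above M"
    using assms(5) by (auto simp: D_minus_com_def)
  obtain Q q where Q: "K_projective_resolution A M Q q"
    and com: "derived_isomorphism A Q (completion_complex A I Q) (\<lambda>i. completion_unit A I (obj Q i))"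
    using assms(5) by (auto simp: D_minus_com_def cohomologically_complete_def)
  obtain P p where P: "K_projective_resolution A M P p" and ten: "derived_zero A (tensor_complex A ?A0 P)"
    using assms(6) by (auto simp: derived_tensor_def)
  have cQ: "is_complex A Q" and q: "quasi_iso A Q M q"
    and KP: "K_projective A P" and cP: "is_complex A P" and p: "quasi_iso A P M p"
    using Q P by (auto simp: K_projective_resolution_def K_projective_def)
  have "is_complex A (tensor_complex A ?A0 P)"
    by (rule tensor_complex_is_complex[OF quot_module_module[OF regular_module_module[OF A]
            ideal_submodule_regular[OF A I]] cP])
  then have acyclic: "cocycles (tensor_complex A ?A0 P) i \<subseteq> coboundaries (tensor_complex A ?A0 P) i" for i
    using ten derived_zero_iff[OF A] by blast
  have step: "cocycles M n \<subseteq> coboundaries M n"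
    if top: "\<And>i. i > n \<Longrightarrow> cocycles M i \<subseteq> coboundaries M i" for n
  proof -
    have pc: "chain_map A P M p" and qc: "chain_map A Q M q" using p q by (auto simp: quasi_iso_def)
    have "cocycles P i \<subseteq> coboundaries P i" if "i > n" for i
      using quasi_iso_inj[OF cP M p] chain_map_cocycles[OF cP M pc] top[OF that] by blast
    then have "cocycles P n \<subseteq> adic_coboundaries A I P n"
      by (rule cocycles_subset_adic_coboundaries[OF A I KP _ acyclic])
    then have "cocycles M n \<subseteq> adic_coboundaries A I M n"
      by (rule quasi_iso_adic_coboundaries_forward[OF A I cP M p])
    then have "cocycles Q n \<subseteq> adic_coboundaries A I Q n"
      by (rule quasi_iso_adic_coboundaries_backward[OF A I cQ M q])
    \<comment> \<open>The unit sends every n-cocycle of \<open>Q\<close> to a coboundary of the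
      completion; as an isomorphism in the derived category it is injective on cohomology.\<close>
    then have QB: "cocycles Q n \<subseteq> coboundaries Q n"
      using derived_isomorphism_inj[OF cQ completion_complex_is_complex[OF A I cQ] com]
        completion_unit_coboundary[OF A I cQ] by blast
    show ?thesis
    proof
      interpret M: module A "obj M n" by (rule complex_module[OF M])
      note B = coboundaries_submodule[OF M, of n]
      fix z assume z: "z \<in> cocycles M n"
      obtain x where x: "x \<in> cocycles Q n" "z \<ominus>\<^bsub>obj M n\<^esub> q n x \<in> coboundaries M n"
        by (rule quasi_iso_surj[OF cQ M q z])
      have qx: "q n x \<in> coboundaries M n" using chain_map_coboundaries[OF qc] x(1) QB by blast
      from submodule_add[OF B x(2) qx] show "z \<in> coboundaries M n"
        using z submodule_subset[OF B qx] by (simp add: cocycles_def M.minus_eq M.a_assoc M.l_neg)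
    qed
  qed
  obtain m where m: "\<And>i. i > m \<Longrightarrow> cocycles M i \<subseteq> coboundaries M i"
    using bounded by (auto simp: cohomology_bounded_above_def cohomology_trivial_iff[OF M])
  \<comment> \<open>Downward induction on the degree, written as induction on the distance
    \<open>k\<close> below the bound \<open>m\<close>; each step adds the single degree m -
    k.\<close>
  have "\<forall>i > m - int k. cocycles M i \<subseteq> coboundaries M i" for k
  proof (induction k)
    case (Suc k)
    show ?case
    proof (intro allI impI)
      fix i assume "i > m - int (Suc k)"
      then have "i = m - int k \<or> i > m - int k" by linarith
      with Suc step[of "m - int k"] show "cocycles M i \<subseteq> coboundaries M i" by blast
    qed
  qed (use m in simp)
  \<comment> \<open>For i at most m this \<open>k\<close> makes the threshold i - 1; for larger i,
    \<open>nat\<close> yields 0 and the threshold is m itself.\<close>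
  moreover have "i > m - int (nat (m - i + 1))" for i by linarith
  ultimately have "cocycles M i \<subseteq> coboundaries M i" for i by blast
  then show ?thesis using derived_zero_iff[OF A M] by blast
qed

end
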